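(* For any finite poset $P$, $f_2^\Box(\mathcal{O}(P))=f_2^\Box(\mathcal{C}(P))$.
   Context: For a finite poset $P$, the order polytope is $\mathcal{O}(P)=\{x\in\mathbb{R}^P: 0\le x_p\le 1 \text{ for all } p\in P,\ x_p\le x_q \text{ whenever } p\le q\}$ and the chain polytope is $\mathcal{C}(P)=\{x\in\mathbb{R}^P: x_p\ge 0 \text{ for all } p,\ x_{p_1}+\dots+x_{p_k}\le 1 \text{ whenever } p_1<\dots<p_k \text{ in } P\}$. For a polytope $\mathcal{P}$, $f_2^\Box(\mathcal{P})$ is the number of $2$-dimensional faces of $\mathcal{P}$ having exactly four vertices (square faces). *)

theory Defs
  imports "HOL-Analysis.Analysis"
begin

text \<open>
  A finite poset is a subset \<open>P\<close> of a finite partially ordered type, with the induced order;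
  unlike \<open>UNIV\<close>, a subset may be empty. \<open>\<real>\<^sup>P\<close> is the coordinate subspace of
  \<open>real ^ 'a\<close> of the vectors that vanish outside \<open>P\<close>.
\<close>

definition order_polytope :: "'a::{finite,order} set \<Rightarrow> (real ^ 'a::{finite,order}) set" where
  "order_polytope P =
     {x. (\<forall>p. p \<notin> P \<longrightarrow> x $ p = 0) \<and>
         (\<forall>p\<in>P. 0 \<le> x $ p \<and> x $ p \<le> 1) \<and>
         (\<forall>p\<in>P. \<forall>q\<in>P. p \<le> q \<longrightarrow> x $ p \<le> x $ q)}"

text \<open>The list \<open>ps\<close> is a chain \<open>p\<^sub>1 < \<dots> < p\<^sub>k\<close> in \<open>P\<close>.\<close>

definition chain_polytope :: "'a::{finite,order} set \<Rightarrow> (real ^ 'a::{finite,order}) set" where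
  "chain_polytope P =
     {x. (\<forall>p. p \<notin> P \<longrightarrow> x $ p = 0) \<and>
         (\<forall>p\<in>P. 0 \<le> x $ p) \<and>
         (\<forall>ps. set ps \<subseteq> P \<and> sorted_wrt (<) ps \<longrightarrow> (\<Sum>p\<leftarrow>ps. x $ p) \<le> 1)}"

text \<open>
  The vertices of a face are its extreme points. Both counted sets are finite when \<open>S\<close> is a
  polytope, so \<open>card\<close> counts genuinely.
\<close>

definition num_square_faces :: "'b::euclidean_space set \<Rightarrow> nat" where
  "num_square_faces S =
     card {F. F face_of S \<and> aff_dim F = 2 \<and> card {v. v extreme_point_of F} = 4}"

end

theory Submission
  imports Defs
begin

text \<open>
  All vertices of both polytopes are 0/1 vectors, so by Radon's theorem a square face is a
  parallelogram \<open>\<chi>\<^sub>A + \<chi>\<^sub>D = \<chi>\<^sub>B + \<chi>\<^sub>C\<close>. For the order polytope the four sets are filters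
  \<open>F\<close>, \<open>F \<union> S\<close>, \<open>F \<union> T\<close>, \<open>F \<union> S \<union> T\<close>, and the parallelogram is a face exactly when \<open>S\<close> and \<open>T\<close>
  are connected. For the chain polytope they are antichains; a face consists of a common part \<open>M\<close>
  and two connected bipartite posets, independently switched between their lower and upper sides.
  Each of these is the set of extremal elements of a unique connected convex set, so both kinds of
  faces are determined by a pair \<open>{S, T}\<close> of such sets together with either a filter or an antichain
  in the set of elements that are incomparable to \<open>S \<union> T\<close>; taking minimal elements matches the two.
\<close>

subsection \<open>Square faces of 0/1 polytopes\<close>

text \<open>A parallelogram is no face once its centre is also the midpoint of a pair of vertices
  outside it. A disconnected \<open>S\<close> supplies such a pair: a part of \<open>S\<close>
  closed under comparability can be exchanged between two opposite corners on its own. Conversely,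
  on a connected piece the equations along comparable pairs leave a single real parameter, so with
  two pieces the face they cut out is parametrised by the unit square. A square of the order
  polytope shows \<open>S\<close> and \<open>T\<close> completely and has a least corner. A square
  of the chain polytope has neither feature: only extremal elements of \<open>S\<close> and
  \<open>T\<close> are visible, and nothing in it tells which side of a piece is the lower one.
  Hence no map is built from one kind of square to the other. Both kinds are images of the same
  triples in \<open>configs\<close>, and the counts agree because the two maps have the same fibres,
  a triple and its swap.\<close>

definition chi :: "'a::finite set \<Rightarrow> real ^ 'a" where
  "chi A = (\<chi> p. of_bool (p \<in> A))"

lemma chi_nth [simp]: "chi A $ p = of_bool (p \<in> A)"
  by (simp add: chi_def)

lemma chi_eq_iff [simp]: "chi A = chi B \<longleftrightarrow> A = B"
  by (auto simp: vec_eq_iff)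

lemma inj_chi: "inj chi"
  by (simp add: inj_def)

lemma chi_in_cube: "chi A \<in> cbox 0 1"
  by (simp add: mem_box_cart)

lemma chi_add_eq_iff:
  "chi A + chi D = chi B + chi C \<longleftrightarrow> A \<inter> D = B \<inter> C \<and> A \<union> D = B \<union> C"
proof -
  have sums: "of_bool a + of_bool d = (of_bool b + of_bool c :: real)
      \<longleftrightarrow> ((a \<and> d \<longleftrightarrow> b \<and> c) \<and> (a \<or> d \<longleftrightarrow> b \<or> c))" for a b c d
    by (cases a; cases b; cases c; cases d; simp)
  show ?thesis
    by (simp only: vec_eq_iff vector_add_component chi_nth sums set_eq_iff Int_iff Un_iff all_conj_distrib)
qed

lemma range_chi_iff: "x \<in> range chi \<longleftrightarrow> (\<forall>p. x $ p = 0 \<or> x $ p = 1)"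
proof
  assume "\<forall>p. x $ p = 0 \<or> x $ p = 1"
  then have "x = chi {p. x $ p = 1}"
    by (auto simp: vec_eq_iff)
  then show "x \<in> range chi"
    by blast
qed auto

text \<open>Every coordinate of a 0/1 vector is an end of the interval from 0 to 1, so the end
  points of an open segment through it must agree with it, and with each other, in every
  coordinate.\<close>

lemma chi_extreme_point_of:
  assumes "S \<subseteq> cbox 0 1" "chi A \<in> S"
  shows "chi A extreme_point_of S"
  unfolding extreme_point_of_def
proof (intro conjI ballI notI assms(2))
  fix a b assume ab: "a \<in> S" "b \<in> S" "chi A \<in> open_segment a b"
  then obtain u where u: "0 < u" "u < 1" "chi A = (1 - u) *\<^sub>R a + u *\<^sub>R b" and "a \<noteq> b"
    by (auto simp: in_segment)
  have "a $ p = b $ p" for p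
  proof -
    have bounds: "0 \<le> a $ p" "a $ p \<le> 1" "0 \<le> b $ p" "b $ p \<le> 1"
      using ab assms(1) by (auto simp: mem_box_cart subset_iff)
    have eq: "(1 - u) * a $ p + u * b $ p = of_bool (p \<in> A)"
      using u(3) by (metis chi_nth scaleR_conv_of_real of_real_eq_id id_apply vector_add_component
          vector_scaleR_component)
    show ?thesis
    proof (cases "p \<in> A")
      case True
      have "(1 - u) * (1 - a $ p) \<ge> 0" "u * (1 - b $ p) \<ge> 0"
        using u bounds by auto
      moreover have "(1 - u) * (1 - a $ p) + u * (1 - b $ p) = 0"
        using eq True by (simp add: algebra_simps)
      ultimately have "(1 - u) * (1 - a $ p) = 0" "u * (1 - b $ p) = 0"
        by linarith+
      with u show ?thesis by simp
    next
      case False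
      have "(1 - u) * a $ p \<ge> 0" "u * b $ p \<ge> 0"
        using u bounds by auto
      moreover have "(1 - u) * a $ p + u * b $ p = 0"
        using eq False by simp
      ultimately have "(1 - u) * a $ p = 0" "u * b $ p = 0"
        by linarith+
      with u show ?thesis by simp
    qed
  qed
  with \<open>a \<noteq> b\<close> show False by (simp add: vec_eq_iff)
qed

lemma hull_chi_subset_cube: "convex hull (chi ` X) \<subseteq> cbox 0 1"
  by (rule hull_minimal) (auto intro: chi_in_cube convex_box)

lemma extreme_points_hull_chi: "{v. v extreme_point_of (convex hull (chi ` X))} = chi ` X"
  using extreme_point_of_convex_hull chi_extreme_point_of[OF hull_chi_subset_cube]
  by (fastforce intro: hull_inc)

lemma hull_chi_inj: "convex hull (chi ` X) = convex hull (chi ` Y) \<longleftrightarrow> X = Y"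
  using inj_image_eq_iff[OF inj_chi] extreme_points_hull_chi by metis

text \<open>The slacks \<open>c - f\<close> are nonnegative on \<open>S\<close>; if a positive
  weighted average of two of them vanishes, both vanish. All faces below are produced from
  supporting equations in this way.\<close>

lemma face_of_equations:
  fixes S :: "'b::real_vector set"
  assumes "convex S"
    and lin: "\<And>f c. (f, c) \<in> \<Phi> \<Longrightarrow> linear f"
    and le: "\<And>f c x. (f, c) \<in> \<Phi> \<Longrightarrow> x \<in> S \<Longrightarrow> f x \<le> (c::real)"
  shows "{x \<in> S. \<forall>(f, c)\<in>\<Phi>. f x = c} face_of S"
proof -
  have eq: "f ((1 - u) *\<^sub>R a + u *\<^sub>R b) = (1 - u) * f a + u * f b"
    if "(f, c) \<in> \<Phi>" for f c a b u
    using lin[OF that] by (simp add: linear_add linear_scale)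
  have "convex {x \<in> S. \<forall>(f, c)\<in>\<Phi>. f x = c}"
    unfolding convex_alt
  proof (intro ballI allI impI CollectI conjI)
    fix x y and u :: real
    assume x: "x \<in> {x \<in> S. \<forall>(f, c)\<in>\<Phi>. f x = c}"
      and y: "y \<in> {x \<in> S. \<forall>(f, c)\<in>\<Phi>. f x = c}" and u: "0 \<le> u \<and> u \<le> 1"
    show "(1 - u) *\<^sub>R x + u *\<^sub>R y \<in> S"
      using assms(1) x y u by (simp add: convex_alt)
    show "case z of (f, c) \<Rightarrow> f ((1 - u) *\<^sub>R x + u *\<^sub>R y) = c" if "z \<in> \<Phi>" for z
    proof (cases z)
      case (Pair f c)
      with x y that have "f x = c" "f y = c" by auto
      then show ?thesis
        using Pair that eq[of f c u x y] by (simp add: algebra_simps)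
    qed
  qed
  moreover have "f a = c \<and> f b = c"
    if prems: "a \<in> S" "b \<in> S" "x \<in> open_segment a b" "(f, c) \<in> \<Phi>" "f x = c" for a b x f c
  proof -
    obtain u where u: "0 < u" "u < 1" "x = (1 - u) *\<^sub>R a + u *\<^sub>R b"
      using prems(3) by (auto simp: in_segment)
    have "(1 - u) * (c - f a) + u * (c - f b) = 0"
      using eq[OF prems(4), of u a b] prems(5) u(3) by (simp add: algebra_simps)
    moreover have "(1 - u) * (c - f a) \<ge> 0" "u * (c - f b) \<ge> 0"
      using u le[OF prems(4)] prems(1,2) by auto
    ultimately have "(1 - u) * (c - f a) = 0" "u * (c - f b) = 0"
      by linarith+
    with u show ?thesis by simp
  qed
  ultimately show ?thesis
    unfolding face_of_def Ball_def split_paired_All prod.case by blast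
qed

text \<open>A coordinate that separates \<open>B\<close> from \<open>C\<close> takes the value
  \<open>u\<close> or \<open>1 - u\<close> on the line, so a 0/1 vector there has \<open>u\<close>
  equal to 0 or 1.\<close>

lemma chi_collinear:
  assumes "chi A = (1 - u) *\<^sub>R chi B + u *\<^sub>R chi C"
  shows "A = B \<or> A = C"
proof (cases "B = C")
  case True
  then show ?thesis
    using assms by (simp flip: scaleR_left_distrib)
next
  case False
  then obtain p where "p \<in> B \<longleftrightarrow> p \<notin> C"
    by blast
  moreover have "of_bool (p \<in> A) = (1 - u) * of_bool (p \<in> B) + u * of_bool (p \<in> C)"
    using arg_cong[OF assms, of "\<lambda>x. x $ p"]
    by (simp only: chi_nth vector_add_component vector_scaleR_component real_scaleR_def)
  ultimately have "u = 0 \<or> u = 1"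
    by (cases "p \<in> A"; cases "p \<in> B") auto
  then show ?thesis
    using assms by auto
qed

text \<open>At a coordinate separating \<open>B\<close> from \<open>C\<close> the right side is
  \<open>t\<close> or \<open>1 - t\<close>, which forces \<open>s = t\<close> or
  \<open>s = 1 - t\<close>. Unless \<open>s\<close> is 1/2, the values 0, \<open>s\<close>,
  \<open>1 - s\<close>, 1 are distinct, and then membership in \<open>A\<close> could be read off
  from \<open>B\<close> or from \<open>C\<close> alone. So the segments bisect each other.\<close>

lemma chi_segments_cross:
  assumes "B \<noteq> C" "A \<noteq> B" "A \<noteq> C" "D \<noteq> B" "D \<noteq> C"
    and eq: "(1 - s) *\<^sub>R chi A + s *\<^sub>R chi D = (1 - t) *\<^sub>R chi B + t *\<^sub>R chi C"
  shows "chi A + chi D = chi B + chi C"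
proof -
  have coord: "(1 - s) * of_bool (p \<in> A) + s * of_bool (p \<in> D)
      = (1 - t) * of_bool (p \<in> B) + t * of_bool (p \<in> C)" for p
    using arg_cong[OF eq, of "\<lambda>x. x $ p"]
    by (simp only: chi_nth vector_add_component vector_scaleR_component real_scaleR_def)
  have s: "s \<noteq> 0" "s \<noteq> 1"
    using eq chi_collinear[of A t B C] chi_collinear[of D t B C] assms by auto
  have t: "t \<noteq> 0" "t \<noteq> 1"
    using eq[symmetric] chi_collinear[of B s A D] chi_collinear[of C s A D] assms by auto
  obtain p where "p \<in> B \<longleftrightarrow> p \<notin> C"
    using \<open>B \<noteq> C\<close> by blast
  then have st: "s = t \<or> s = 1 - t"
    using coord[of p] s t by (cases "p \<in> A"; cases "p \<in> B"; cases "p \<in> D") auto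
  have s2: "s = 1 / 2"
  proof (rule ccontr)
    assume half: "s \<noteq> 1 / 2"
    have "p \<in> A \<longleftrightarrow> (if s = t then p \<in> B else p \<in> C)" for p
      using coord[of p] s t st half
      by (cases "p \<in> A"; cases "p \<in> B"; cases "p \<in> C"; cases "p \<in> D") auto
    then have "A = B \<or> A = C"
      by (cases "s = t") (simp_all add: set_eq_iff)
    with assms show False by simp
  qed
  with st have t2: "t = 1 / 2" by auto
  have half: "a + d = b + c" if "(1 - 1 / 2) * a + 1 / 2 * d = (1 - 1 / 2) * b + 1 / 2 * c"
    for a b c d :: real
    using that by simp
  have "of_bool (p \<in> A) + of_bool (p \<in> D) = of_bool (p \<in> B) + (of_bool (p \<in> C) :: real)" for p
    by (rule half[OF coord[of p, unfolded s2 t2]])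
  then show ?thesis
    unfolding vec_eq_iff vector_add_component chi_nth by blast
qed

section \<open>Parallelograms of 0/1 vectors as square faces\<close>

text \<open>\<open>A\<close> and \<open>D\<close> are opposite corners, and the two set equations
  say \<open>chi A + chi D = chi B + chi C\<close>. The two inequalities suffice to make all four
  sets distinct.\<close>

definition parallelogram :: "'a set \<Rightarrow> 'a set \<Rightarrow> 'a set \<Rightarrow> 'a set \<Rightarrow> bool" where
  "parallelogram A B C D \<longleftrightarrow> A \<noteq> B \<and> A \<noteq> C \<and> A \<inter> D = B \<inter> C \<and> A \<union> D = B \<union> C"

definition square_sets :: "(real ^ 'a::finite) set \<Rightarrow> 'a set set set" where
  "square_sets S = {{A, B, C, D} | A B C D.
     parallelogram A B C D \<and> convex hull (chi ` {A, B, C, D}) face_of S}"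

lemma parallelogram_distinct:
  assumes "parallelogram A B C D"
  shows "A \<noteq> B" "A \<noteq> C" "A \<noteq> D" "B \<noteq> C" "B \<noteq> D" "C \<noteq> D"
  using assms unfolding parallelogram_def by blast+

text \<open>The parallelogram relation puts \<open>chi D\<close> into the affine hull of the other
  three corners, and those are not collinear because a line contains at most two 0/1
  vectors.\<close>

lemma aff_dim_parallelogram:
  assumes "parallelogram A B C D"
  shows "aff_dim (chi ` {A, B, C, D}) = 2"
proof -
  have "chi A + chi D = chi B + chi C"
    using assms by (simp add: chi_add_eq_iff parallelogram_def)
  then have D: "chi D = (-1) *\<^sub>R chi A + 1 *\<^sub>R chi B + 1 *\<^sub>R chi C"
    by (simp add: algebra_simps)
  have "chi D \<in> affine hull {chi A, chi B, chi C}"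
    unfolding affine_hull_3 D by (rule CollectI, rule exI[of _ "-1"], rule exI[of _ 1], rule exI[of _ 1]) simp
  moreover have "chi A \<notin> affine hull {chi B, chi C}"
    unfolding affine_hull_2 using chi_collinear[of A _ B C] parallelogram_distinct[OF assms]
    by (auto simp: eq_diff_eq[symmetric])
  moreover have "B \<noteq> C"
    using parallelogram_distinct[OF assms] by simp
  moreover have "chi ` {A, B, C, D} = insert (chi D) (insert (chi A) {chi B, chi C})"
    by auto
  ultimately show ?thesis
    by (simp only: aff_dim_insert aff_dim_2 chi_eq_iff) (simp add: insert_commute)
qed

lemma square_face_parallelogram:
  fixes T :: "(real ^ 'a::finite) set"
  assumes "compact T" "convex T" and ext: "{v. v extreme_point_of T} = chi ` Q"
    and "card Q = 4" "aff_dim T = 2"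
  obtains A B C D where "Q = {A, B, C, D}" "parallelogram A B C D"
proof -
  have T: "T = convex hull (chi ` Q)"
    using Krein_Milman_Minkowski[OF assms(1,2)] ext by simp
  have "finite Q"
    using assms(4) card.infinite by fastforce
  have card: "card (chi ` Q) = 4"
    using assms(4) by (simp add: card_image inj_on_def)
  have "aff_dim (chi ` Q) = 2"
    using assms(5) by (simp add: T aff_dim_convex_hull)
  then have "affine_dependent (chi ` Q)"
    using affine_independent_iff_card[of "chi ` Q"] card by auto
  then obtain M N where MN: "M \<inter> N = {}" "M \<union> N = chi ` Q" "convex hull M \<inter> convex hull N \<noteq> {}"
    using Radon_partition[of "chi ` Q"] \<open>finite Q\<close> by auto
  have "M \<subseteq> range chi" "N \<subseteq> range chi"
    using MN(2) by blast+
  then obtain M' N' where M': "M = chi ` M'" and N': "N = chi ` N'"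
    unfolding subset_image_iff by auto
  have disj: "M' \<inter> N' = {}" and un: "M' \<union> N' = Q"
    using MN(1,2) unfolding M' N' by (auto simp flip: image_Un simp: inj_image_eq_iff[OF inj_chi])
  have fin: "finite M'" "finite N'"
    using un \<open>finite Q\<close> by auto
  have notin: "chi A \<notin> convex hull (chi ` Z)" if "A \<notin> Z" for A and Z :: "'a set set"
    using extreme_point_of_convex_hull[OF chi_extreme_point_of[OF hull_chi_subset_cube, of A Z]] that
    by (auto simp: image_iff)
  \<comment> \<open>No vertex lies in the hull of other vertices, so neither side of the Radon
    partition is a single point. Four points are therefore split two against two: the
    diagonals.\<close>
  have two: "card Z \<ge> 2" if prems: "Z \<inter> W = {}" "convex hull (chi ` Z) \<inter> convex hull (chi ` W) \<noteq> {}"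
      "finite Z" for Z W :: "'a set set"
  proof (rule ccontr)
    assume "\<not> card Z \<ge> 2"
    with \<open>finite Z\<close> have "Z = {} \<or> (\<exists>z. Z = {z})"
      by (metis card_0_eq card_1_singletonE less_2_cases linorder_not_le One_nat_def)
    then show False
    proof
      assume "\<exists>z. Z = {z}"
      then obtain z where "Z = {z}" ..
      then show False
        using notin[of z W] prems(1,2) by simp
    qed (use prems(2) in simp)
  qed
  have "card M' \<ge> 2" "card N' \<ge> 2"
    using two[of M' N'] two[of N' M'] disj MN(3) fin unfolding M' N' by (auto simp: Int_commute)
  moreover have "card M' + card N' = 4"
    using disj un fin assms(4) card_Un_disjoint by metis
  ultimately have "card M' = 2" "card N' = 2"
    by auto
  then obtain A D B C where AD: "M' = {A, D}" "A \<noteq> D" and BC: "N' = {B, C}" "B \<noteq> C"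
    by (meson card_2_iff)
  obtain s t where "(1 - s) *\<^sub>R chi A + s *\<^sub>R chi D = (1 - t) *\<^sub>R chi B + t *\<^sub>R chi C"
    using MN(3) unfolding M' N' AD BC by (force simp: closed_segment_def simp flip: segment_convex_hull)
  then have "chi A + chi D = chi B + chi C"
    using disj AD BC by (intro chi_segments_cross) auto
  then have "A \<inter> D = B \<inter> C" "A \<union> D = B \<union> C"
    by (simp_all add: chi_add_eq_iff)
  moreover have "Q = {A, B, C, D}" "A \<noteq> B" "A \<noteq> C"
    using disj un AD BC by auto
  ultimately show ?thesis
    by (intro that[unfolded parallelogram_def] conjI)
qed

lemma num_square_faces_eq:
  fixes S :: "(real ^ 'a::finite) set"
  assumes "compact S" "convex S" and ext: "\<And>x. x extreme_point_of S \<Longrightarrow> x \<in> range chi"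
  shows "num_square_faces S = card (square_sets S)"
proof -
  let ?h = "\<lambda>X. convex hull (chi ` X)"
  let ?R = "{F. F face_of S \<and> aff_dim F = 2 \<and> card {v. v extreme_point_of F} = 4}"
  have "?h X \<in> ?R" if X: "X \<in> square_sets S" for X
  proof -
    obtain A B C D where X_eq: "X = {A, B, C, D}" and d: "parallelogram A B C D"
      and "convex hull (chi ` {A, B, C, D}) face_of S"
      using X unfolding square_sets_def by (elim CollectE exE conjE) (rule that)
    then have "?h X face_of S"
      by (simp only: X_eq)
    moreover have "card (chi ` X) = 4"
      using parallelogram_distinct[OF d] X_eq by (simp add: card_image inj_on_def)
    moreover have "aff_dim (?h X) = 2"
      using aff_dim_parallelogram[OF d] X_eq by (simp add: aff_dim_convex_hull)
    ultimately show ?thesis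
      by (simp add: extreme_points_hull_chi)
  qed
  moreover have "T \<in> ?h ` square_sets S" if "T \<in> ?R" for T
  proof -
    have T: "T face_of S" "aff_dim T = 2" "card {v. v extreme_point_of T} = 4"
      using that by auto
    have "{v. v extreme_point_of T} \<subseteq> range chi"
      using ext extreme_point_of_face[OF T(1)] by blast
    then obtain Q where Q: "{v. v extreme_point_of T} = chi ` Q"
      unfolding subset_image_iff by auto
    have "card Q = 4"
      using T(3) unfolding Q by (simp add: card_image inj_on_def)
    have cT: "compact T" "convex T"
      using T(1) assms face_of_imp_compact face_of_imp_convex by auto
    then obtain A B C D where "Q = {A, B, C, D}" "parallelogram A B C D"
      using square_face_parallelogram[OF cT Q \<open>card Q = 4\<close> T(2)] by metis
    moreover have "T = ?h Q"
      using Krein_Milman_Minkowski[OF cT] Q by simp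
    ultimately have "Q \<in> square_sets S"
      using T(1) unfolding square_sets_def by blast
    with \<open>T = ?h Q\<close> show ?thesis by blast
  qed
  ultimately have "?h ` square_sets S = ?R"
    by blast
  moreover have "inj_on ?h (square_sets S)"
    by (simp add: inj_on_def hull_chi_inj)
  ultimately show ?thesis
    unfolding num_square_faces_def by (metis card_image)
qed

text \<open>How the face property is exploited: a pair \<open>E\<close>, \<open>G\<close> with the
  same intersection and union as \<open>A\<close>, \<open>D\<close> has the same midpoint as the
  diagonal, so both its points are pulled into the face, where the only 0/1 vectors are the
  corners.\<close>

lemma square_face_closed:
  assumes "convex hull (chi ` {A, B, C, D}) face_of S" "A \<noteq> D"
    and "chi E \<in> S" "chi G \<in> S" "E \<inter> G = A \<inter> D" "E \<union> G = A \<union> D"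
  shows "E \<in> {A, B, C, D}"
proof -
  let ?T = "convex hull (chi ` {A, B, C, D})"
  have "E \<noteq> G"
    using assms by blast
  have "chi E + chi G = chi A + chi D"
    using assms by (simp add: chi_add_eq_iff)
  then have "midpoint (chi E) (chi G) = midpoint (chi A) (chi D)"
    by (simp add: midpoint_def)
  moreover have "midpoint (chi A) (chi D) \<in> ?T"
    using midpoint_in_closed_segment[of "chi A" "chi D"]
      hull_mono[of "{chi A, chi D}" "chi ` {A, B, C, D}" convex]
    by (auto simp: segment_convex_hull)
  ultimately have "chi E \<in> ?T"
    using face_ofD[OF assms(1), of "midpoint (chi A) (chi D)" "chi E" "chi G"] assms(3,4) \<open>E \<noteq> G\<close>
    by (metis chi_eq_iff midpoint_in_open_segment)
  then have "chi E \<in> chi ` {A, B, C, D}"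
    using chi_extreme_point_of[OF hull_chi_subset_cube] extreme_points_hull_chi by blast
  then show ?thesis
    by auto
qed

text \<open>Interpolate by \<open>s\<close> along two opposite sides, then by \<open>t\<close>
  between the results. In both polytopes \<open>s\<close> and \<open>t\<close> will be the
  parameters of the two connected pieces.\<close>

lemma bilinear_in_hull:
  fixes a b c d :: "'b::real_vector"
  assumes "0 \<le> s" "s \<le> 1" "0 \<le> t" "t \<le> (1::real)"
  shows "(s * t) *\<^sub>R a + ((1 - s) * t) *\<^sub>R b + (s * (1 - t)) *\<^sub>R c + ((1 - s) * (1 - t)) *\<^sub>R d
    \<in> convex hull {a, b, c, d}"
proof -
  have "t *\<^sub>R (s *\<^sub>R a + (1 - s) *\<^sub>R b) + (1 - t) *\<^sub>R (s *\<^sub>R c + (1 - s) *\<^sub>R d) \<in> convex hull {a, b, c, d}"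
    using assms by (intro convexD[OF convex_convex_hull] hull_inc) auto
  then show ?thesis
    by (simp add: algebra_simps)
qed

subsection \<open>Order and chain polytopes\<close>

definition filter_in :: "'a::order set \<Rightarrow> 'a set \<Rightarrow> bool" where
  "filter_in P F \<longleftrightarrow> F \<subseteq> P \<and> (\<forall>x\<in>F. \<forall>y\<in>P. x \<le> y \<longrightarrow> y \<in> F)"

definition antichain_in :: "'a::order set \<Rightarrow> 'a set \<Rightarrow> bool" where
  "antichain_in P A \<longleftrightarrow> A \<subseteq> P \<and> (\<forall>x\<in>A. \<forall>y\<in>A. \<not> x < y)"

lemma chi_in_order_polytope_iff: "chi A \<in> order_polytope P \<longleftrightarrow> filter_in P A"
proof -
  have le: "of_bool b \<le> (of_bool c :: real) \<longleftrightarrow> (b \<longrightarrow> c)" for b c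
    by simp
  show ?thesis
    unfolding order_polytope_def filter_in_def mem_Collect_eq chi_nth le by auto
qed

text \<open>A chain meets an antichain at most once: after the first hit the remaining terms are all
  0.\<close>

lemma sum_list_chi_le_1:
  assumes "antichain_in P A" "sorted_wrt (<) ps"
  shows "(\<Sum>p\<leftarrow>ps. chi A $ p) \<le> 1"
  using assms(2)
proof (induction ps)
  case (Cons p ps)
  show ?case
  proof (cases "p \<in> A")
    case True
    then have "(\<Sum>q\<leftarrow>ps. chi A $ q) = (\<Sum>q\<leftarrow>ps. 0)"
      using Cons.prems assms(1) by (intro arg_cong[where f = sum_list] map_cong) (auto simp: antichain_in_def)
    with True show ?thesis by simp
  qed (use Cons in simp)
qed simp

lemma chi_in_chain_polytope_iff: "chi A \<in> chain_polytope P \<longleftrightarrow> antichain_in P A"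
proof
  assume "antichain_in P A"
  then show "chi A \<in> chain_polytope P"
    unfolding chain_polytope_def mem_Collect_eq
    using sum_list_chi_le_1[of P A] by (auto simp: antichain_in_def simp del: chi_nth) (auto)
next
  assume A: "chi A \<in> chain_polytope P"
  then have "A \<subseteq> P"
    by (auto simp: chain_polytope_def)
  moreover have False if "x \<in> A" "y \<in> A" "x < y" for x y
  proof -
    have "set [x, y] \<subseteq> P \<and> sorted_wrt (<) [x, y]"
      using that \<open>A \<subseteq> P\<close> by auto
    then have "(\<Sum>p\<leftarrow>[x, y]. chi A $ p) \<le> 1"
      using A unfolding chain_polytope_def by blast
    with that show False by simp
  qed
  ultimately show "antichain_in P A"
    unfolding antichain_in_def by blast
qed

lemma order_polytope_subset_cube: "order_polytope P \<subseteq> cbox 0 1"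
proof
  fix x assume "x \<in> order_polytope P"
  then have "0 \<le> x $ p \<and> x $ p \<le> 1" for p
    by (cases "p \<in> P") (auto simp: order_polytope_def)
  then show "x \<in> cbox 0 1"
    by (simp add: mem_box_cart)
qed

lemma chain_polytopeD:
  assumes "x \<in> chain_polytope P"
  shows "p \<notin> P \<Longrightarrow> x $ p = 0" "0 \<le> x $ p" "x $ p \<le> 1"
    and "p \<in> P \<Longrightarrow> q \<in> P \<Longrightarrow> p < q \<Longrightarrow> x $ p + x $ q \<le> 1"
proof -
  show 0: "p \<notin> P \<Longrightarrow> x $ p = 0"
    using assms by (auto simp: chain_polytope_def)
  show "0 \<le> x $ p"
    using assms 0 by (cases "p \<in> P") (auto simp: chain_polytope_def)
  have chain: "(\<Sum>p\<leftarrow>ps. x $ p) \<le> 1" if "set ps \<subseteq> P" "sorted_wrt (<) ps" for ps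
    using assms that by (auto simp: chain_polytope_def)
  show "x $ p \<le> 1"
    using chain[of "[p]"] 0 by (cases "p \<in> P") auto
  show "p \<in> P \<Longrightarrow> q \<in> P \<Longrightarrow> p < q \<Longrightarrow> x $ p + x $ q \<le> 1"
    using chain[of "[p, q]"] by auto
qed

lemma chain_polytope_subset_cube: "chain_polytope P \<subseteq> cbox 0 1"
  using chain_polytopeD by (auto simp: mem_box_cart)

section \<open>Compactness and convexity\<close>

lemma closed_Collect_const_imp: "(P \<Longrightarrow> closed {x. Q x}) \<Longrightarrow> closed {x. P \<longrightarrow> Q x}"
  by (cases P) auto

lemma continuous_on_sum_list_nth: "continuous_on S (\<lambda>x :: real ^ 'a::finite. \<Sum>p\<leftarrow>ps. x $ p)"
  by (induction ps) (auto intro!: continuous_intros)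

lemma compact_order_polytope: "compact (order_polytope P)"
proof -
  have "closed (order_polytope P)"
    unfolding order_polytope_def Ball_def
    by (intro closed_Collect_conj closed_Collect_all closed_Collect_const_imp closed_Collect_le
        closed_Collect_eq continuous_intros)
  then show ?thesis
    using order_polytope_subset_cube bounded_subset[OF bounded_cbox] by (simp add: compact_eq_bounded_closed) blast
qed

lemma compact_chain_polytope: "compact (chain_polytope P)"
proof -
  have "closed (chain_polytope P)"
    unfolding chain_polytope_def Ball_def
    by (intro closed_Collect_conj closed_Collect_all closed_Collect_const_imp closed_Collect_le
        closed_Collect_eq continuous_intros continuous_on_sum_list_nth)
  then show ?thesis
    using chain_polytope_subset_cube bounded_subset[OF bounded_cbox] by (simp add: compact_eq_bounded_closed) blast
qed

lemma convex_order_polytope: "convex (order_polytope P)"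
proof -
  have "a * s + b * t \<le> a * s' + b * t'" if "s \<le> s'" "t \<le> t'" "0 \<le> a" "0 \<le> b"
    for a b s t s' t' :: real
    using that by (intro add_mono mult_left_mono)
  then show ?thesis
    unfolding order_polytope_def by (auto simp: convex_def intro: convex_bound_le)
qed

lemma convex_chain_polytope: "convex (chain_polytope P)"
proof -
  have "(\<Sum>p\<leftarrow>ps. (u *\<^sub>R x + v *\<^sub>R y) $ p) = u * (\<Sum>p\<leftarrow>ps. x $ p) + v * (\<Sum>p\<leftarrow>ps. y $ p)"
    for ps u v and x y :: "real ^ 'a::{finite,order}"
    by (induction ps) (auto simp: algebra_simps)
  then show ?thesis
    unfolding chain_polytope_def
    by (intro convexI) (auto intro: convex_bound_le simp del: vector_add_component vector_scaleR_component, auto)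
qed

section \<open>Integrality of the vertices\<close>

lemma extreme_point_midpoint:
  fixes x :: "real ^ 'a::finite"
  assumes "x extreme_point_of S" "y \<in> S" "z \<in> S" "\<And>p. y $ p + z $ p = 2 * x $ p"
  shows "y = x"
proof (cases "y = z")
  case True
  then show ?thesis using assms(4) by (simp add: vec_eq_iff)
next
  case False
  have "x = midpoint y z"
    using assms(4) by (simp add: midpoint_def vec_eq_iff)
  with False assms(1-3) show ?thesis
    unfolding extreme_point_of_def by (metis midpoint_in_open_segment)
qed

text \<open>The clipping functions \<open>min 1 (2 * t)\<close> and \<open>max 0 (2 * t - 1)\<close> are monotone and add up
  to \<open>2 * t\<close>, so they exhibit every point of the order polytope as a midpoint.\<close>

lemma extreme_point_order_polytope:
  assumes "x extreme_point_of order_polytope P"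
  shows "x \<in> range chi"
proof -
  have x: "x \<in> order_polytope P"
    using assms by (simp add: extreme_point_of_def)
  have "(\<chi> p. min 1 (2 * x $ p)) = x"
  proof (rule extreme_point_midpoint[OF assms])
    show "(\<chi> p. min 1 (2 * x $ p)) \<in> order_polytope P"
      using x by (fastforce simp: order_polytope_def)
    show "(\<chi> p. max 0 (2 * x $ p - 1)) \<in> order_polytope P"
      using x by (fastforce simp: order_polytope_def)
  qed (auto simp: min_def max_def)
  then have "min 1 (2 * x $ p) = x $ p" for p
    by (metis vec_lambda_beta)
  then have "x $ p = 0 \<or> x $ p = 1" for p
    by (smt (verit))
  then show ?thesis
    by (simp add: range_chi_iff)
qed

definition chains_below :: "'a::order set \<Rightarrow> 'a \<Rightarrow> 'a list set" where
  "chains_below P p = {ps. set ps \<subseteq> P \<and> sorted_wrt (<) ps \<and> (\<forall>q\<in>set ps. q < p)}"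

text \<open>The weight of a heaviest chain strictly below \<open>p\<close>, so that
  \<open>depth P x p + x $ p\<close> is the weight of a heaviest chain ending in \<open>p\<close>
  when \<open>p\<close> belongs to \<open>P\<close>. The empty chain always competes, hence the
  maximum exists and is nonnegative.\<close>

definition depth :: "'a::{finite,order} set \<Rightarrow> (real ^ 'a::{finite,order}) \<Rightarrow> 'a \<Rightarrow> real" where
  "depth P x p = Max ((\<lambda>ps. \<Sum>q\<leftarrow>ps. x $ q) ` chains_below P p)"

lemma finite_chains_below: "finite (chains_below P (p :: 'a::{finite,order}))"
proof (rule finite_subset)
  show "chains_below P p \<subseteq> {ps. set ps \<subseteq> UNIV \<and> length ps \<le> CARD('a)}"
  proof
    fix ps assume "ps \<in> chains_below P p"
    then have "sorted_wrt (<) ps"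
      by (simp add: chains_below_def)
    then have "distinct ps"
      by (induction ps) auto
    then show "ps \<in> {ps. set ps \<subseteq> UNIV \<and> length ps \<le> CARD('a)}"
      by (auto simp flip: distinct_card intro: card_mono)
  qed
qed (rule finite_lists_length_le, simp)

lemma depth_ge: "ps \<in> chains_below P p \<Longrightarrow> (\<Sum>q\<leftarrow>ps. x $ q) \<le> depth P x p"
  unfolding depth_def using finite_chains_below by (intro Max_ge) auto

lemma depth_nonneg: "0 \<le> depth P x p"
  using depth_ge[of "[]" P p x] by (simp add: chains_below_def)

lemma depth_attained: obtains ps where "ps \<in> chains_below P p" "depth P x p = (\<Sum>q\<leftarrow>ps. x $ q)"
proof -
  have "[] \<in> chains_below P p"
    by (simp add: chains_below_def)
  then have "depth P x p \<in> (\<lambda>ps. \<Sum>q\<leftarrow>ps. x $ q) ` chains_below P p"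
    unfolding depth_def using finite_chains_below by (intro Max_in) auto
  then show ?thesis using that by blast
qed

lemma snoc_chains_below:
  "ps @ [q] \<in> chains_below P p \<longleftrightarrow> ps \<in> chains_below P q \<and> q \<in> P \<and> q < p"
  by (auto simp: chains_below_def sorted_wrt_append dest: less_trans)

lemma depth_step:
  assumes "q \<in> P" "q < p"
  shows "depth P x q + x $ q \<le> depth P x p"
proof -
  obtain ps where ps: "ps \<in> chains_below P q" "depth P x q = (\<Sum>q\<leftarrow>ps. x $ q)"
    by (rule depth_attained)
  then show ?thesis
    using depth_ge[of "ps @ [q]" P p x] assms by (simp add: snoc_chains_below)
qed

text \<open>The last element of a heaviest chain turns \<open>depth_step\<close> into an equality;
  this is the recursion along which integrality spreads upwards.\<close>

lemma depth_cases:
  assumes "depth P x p \<noteq> 0"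
  obtains q where "q \<in> P" "q < p" "depth P x p = depth P x q + x $ q"
proof -
  obtain ps where ps: "ps \<in> chains_below P p" "depth P x p = (\<Sum>q\<leftarrow>ps. x $ q)"
    by (rule depth_attained)
  with assms obtain qs q where "ps = qs @ [q]"
    by (cases ps rule: rev_cases) auto
  with ps have q: "qs \<in> chains_below P q" "q \<in> P" "q < p"
    by (auto simp: snoc_chains_below)
  moreover have "depth P x p \<le> depth P x q + x $ q"
    using ps depth_ge[OF q(1), of x] \<open>ps = qs @ [q]\<close> by simp
  ultimately show ?thesis
    using that depth_step[OF q(2,3), of x] by auto
qed

lemma depth_add_le_1:
  assumes "x \<in> chain_polytope P" "p \<in> P"
  shows "depth P x p + x $ p \<le> 1"
proof -
  obtain ps where ps: "ps \<in> chains_below P p" "depth P x p = (\<Sum>q\<leftarrow>ps. x $ q)"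
    by (rule depth_attained)
  then have "set (ps @ [p]) \<subseteq> P \<and> sorted_wrt (<) (ps @ [p])"
    using assms(2) by (auto simp: chains_below_def sorted_wrt_append)
  then have "(\<Sum>q\<leftarrow>ps @ [p]. x $ q) \<le> 1"
    using assms(1) unfolding chain_polytope_def by blast
  with ps show ?thesis by simp
qed

text \<open>This is Stanley's transfer map in disguise: \<open>\<lambda>p. depth P x p + x $ p\<close> lies in the order
  polytope, and composing it with \<open>f\<close> before transferring back stays in the chain polytope.\<close>

lemma transfer_in_chain_polytope:
  assumes x: "x \<in> chain_polytope P" and "mono f" "f 0 = 0" "f 1 = (1::real)"
  shows "(\<chi> p. if p \<in> P then f (depth P x p + x $ p) - f (depth P x p) else 0) \<in> chain_polytope P"
    (is "?y \<in> _")
proof -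
  note mono = monoD[OF \<open>mono f\<close>]
  \<comment> \<open>Along a chain the intervals from \<open>depth P x q\<close> to
    \<open>depth P x q + x $ q\<close> follow one another without overlap, so the increments of the
    monotone \<open>f\<close> over them add up to at most \<open>f\<close> at the depth of
    \<open>p\<close>.\<close>
  have below: "(\<Sum>q\<leftarrow>ps. ?y $ q) \<le> f (depth P x p)" if "ps \<in> chains_below P p" for ps p
    using that
  proof (induction ps arbitrary: p rule: rev_induct)
    case Nil
    then show ?case using mono[OF depth_nonneg] \<open>f 0 = 0\<close> by simp
  next
    case (snoc q ps)
    then have q: "ps \<in> chains_below P q" "q \<in> P" "q < p"
      by (auto simp: snoc_chains_below)
    have "(\<Sum>r\<leftarrow>ps. ?y $ r) \<le> f (depth P x q)"
      by (rule snoc.IH[OF q(1)])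
    then show ?case
      using mono[OF depth_step[OF q(2,3), of x]] q(2) by simp
  qed
  have "(\<Sum>p\<leftarrow>ps. ?y $ p) \<le> 1" if "set ps \<subseteq> P" "sorted_wrt (<) ps" for ps
  proof (cases ps rule: rev_cases)
    case (snoc qs q)
    then have "qs \<in> chains_below P q" "q \<in> P"
      using that by (auto simp: chains_below_def sorted_wrt_append)
    then have "(\<Sum>p\<leftarrow>ps. ?y $ p) \<le> f (depth P x q + x $ q)"
      using below[of qs q] snoc by simp
    also have "\<dots> \<le> 1"
      using mono[OF depth_add_le_1[OF x \<open>q \<in> P\<close>]] \<open>f 1 = 1\<close> by simp
    finally show ?thesis .
  qed simp
  moreover have "0 \<le> ?y $ p" for p
    using chain_polytopeD(2)[OF x, of p] by (simp add: mono)
  moreover have "?y $ p = 0" if "p \<notin> P" for p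
    using that by simp
  ultimately show ?thesis
    unfolding chain_polytope_def mem_Collect_eq by blast
qed

text \<open>The two clipping functions, pushed through the transfer map, give points
  \<open>y\<close> and \<open>z\<close> with midpoint \<open>x\<close>. Extremality yields
  \<open>y = x\<close>, so doubling and clipping the heaviest-chain weights leaves all their
  increments unchanged.\<close>

lemma extreme_point_chain_polytope:
  assumes "x extreme_point_of chain_polytope P"
  shows "x \<in> range chi"
proof -
  have x: "x \<in> chain_polytope P"
    using assms by (simp add: extreme_point_of_def)
  define f where "f t = min 1 (2 * t)" for t :: real
  define g where "g t = max 0 (2 * t - 1)" for t :: real
  define y where "y = (\<chi> p. if p \<in> P then f (depth P x p + x $ p) - f (depth P x p) else 0)"
  define z where "z = (\<chi> p. if p \<in> P then g (depth P x p + x $ p) - g (depth P x p) else 0)"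
  have "y = x"
  proof (rule extreme_point_midpoint[OF assms])
    show "y \<in> chain_polytope P"
      unfolding y_def by (rule transfer_in_chain_polytope[OF x]) (auto simp: f_def mono_def)
    show "z \<in> chain_polytope P"
      unfolding z_def by (rule transfer_in_chain_polytope[OF x]) (auto simp: g_def mono_def)
    have "f t + g t = 2 * t" for t
      by (simp add: f_def g_def min_def max_def)
    then have "y $ p + z $ p = (if p \<in> P then 2 * (depth P x p + x $ p) - 2 * depth P x p else 0)" for p
      unfolding y_def z_def by (simp, smt (verit))
    then show "y $ p + z $ p = 2 * x $ p" for p
      using chain_polytopeD(1)[OF x] by auto
  qed
  have fixed: "f (depth P x p + x $ p) - f (depth P x p) = x $ p" if "p \<in> P" for p
    using arg_cong[OF \<open>y = x\<close>, of "\<lambda>v. v $ p"] that unfolding y_def by simp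
  \<comment> \<open>Induction from the bottom of the order: a nonzero depth is inherited from some
    \<open>q\<close> below \<open>p\<close>. At depth 0 an increment preserved by \<open>f\<close>
    is 0 or 1, and at depth 1 it is 0.\<close>
  have depth01: "depth P x p \<in> {0, 1} \<and> (p \<in> P \<longrightarrow> depth P x p + x $ p \<in> {0, 1})" for p
  proof (induction "card {q. q < p}" arbitrary: p rule: less_induct)
    case less
    have d: "depth P x p \<in> {0, 1}"
    proof (cases "depth P x p = 0")
      case False
      then obtain q where q: "q \<in> P" "q < p" "depth P x p = depth P x q + x $ q"
        by (rule depth_cases)
      then have "{r. r < q} \<subset> {r. r < p}"
        by auto
      with q show ?thesis
        using less[of q] psubset_card_mono[of "{r. r < p}" "{r. r < q}"] by simp
    qed simp
    moreover have "depth P x p + x $ p \<in> {0, 1}" if "p \<in> P"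
      using fixed[OF that] d by (auto simp: f_def min_def split: if_splits)
    ultimately show ?case by blast
  qed
  have "x $ p = 0 \<or> x $ p = 1" for p
    using depth01[of p] chain_polytopeD(1,2)[OF x, of p] by (cases "p \<in> P") auto
  then show ?thesis
    by (simp add: range_chi_iff)
qed

subsection \<open>Square faces of the order polytope\<close>

definition comparable :: "'a::order \<Rightarrow> 'a \<Rightarrow> bool" where
  "comparable x y \<longleftrightarrow> x \<le> y \<or> y \<le> x"

lemma comparable_sym: "comparable x y \<longleftrightarrow> comparable y x"
  by (auto simp: comparable_def)

text \<open>Connectedness of the comparability graph on a nonempty set, expressed without paths.
  Sets \<open>E\<close> closed under comparability are exactly what can be exchanged between
  opposite corners of a square, so this form matches the face argument.\<close>

definition conn :: "'a::order set \<Rightarrow> bool" where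
  "conn S \<longleftrightarrow> S \<noteq> {} \<and>
     (\<forall>E\<subseteq>S. E \<noteq> {} \<longrightarrow> (\<forall>x\<in>E. \<forall>y\<in>S. comparable x y \<longrightarrow> y \<in> E) \<longrightarrow> E = S)"

lemma connI:
  assumes "S \<noteq> {}"
    and "\<And>E. E \<subseteq> S \<Longrightarrow> E \<noteq> {} \<Longrightarrow> (\<And>x y. x \<in> E \<Longrightarrow> y \<in> S \<Longrightarrow> comparable x y \<Longrightarrow> y \<in> E) \<Longrightarrow> E = S"
  shows "conn S"
  using assms unfolding conn_def by blast

lemma conn_closed:
  assumes "conn S" "E \<subseteq> S" "E \<noteq> {}" "\<And>x y. x \<in> E \<Longrightarrow> y \<in> S \<Longrightarrow> comparable x y \<Longrightarrow> y \<in> E"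
  shows "E = S"
  using assms unfolding conn_def by blast

lemma conn_nonempty: "conn S \<Longrightarrow> S \<noteq> {}"
  by (simp add: conn_def)

lemma conn_induct [consumes 3, case_names step]:
  assumes "conn S" "x \<in> S" "w \<in> S" "Q x"
    and step: "\<And>y z. y \<in> S \<Longrightarrow> z \<in> S \<Longrightarrow> comparable y z \<Longrightarrow> Q y \<Longrightarrow> Q z"
  shows "Q w"
proof -
  have "{y \<in> S. Q y} = S"
    using assms(2,4) step by (intro conn_closed[OF assms(1)]) auto
  then show ?thesis
    using assms(3) by blast
qed

text \<open>The pair \<open>S\<close>, \<open>T\<close> is ordered, so every square is produced
  twice, in both polytopes alike. The filter conditions already force \<open>S\<close> and
  \<open>T\<close> to be order-convex in \<open>P\<close> and mutually incomparable.\<close>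

definition configs :: "'a::order set \<Rightarrow> ('a set \<times> 'a set \<times> 'a set) set" where
  "configs P = {(F, S, T). filter_in P F \<and> filter_in P (F \<union> S) \<and> filter_in P (F \<union> T) \<and>
     F \<inter> S = {} \<and> F \<inter> T = {} \<and> S \<inter> T = {} \<and> conn S \<and> conn T}"

lemma configsD:
  assumes "(F, S, T) \<in> configs P"
  shows "filter_in P F" "filter_in P (F \<union> S)" "filter_in P (F \<union> T)"
    "F \<inter> S = {}" "F \<inter> T = {}" "S \<inter> T = {}" "conn S" "conn T"
    "filter_in P (F \<union> S \<union> T)" "F \<subseteq> P" "S \<subseteq> P" "T \<subseteq> P"
  using assms unfolding configs_def filter_in_def by auto

lemma configs_swap: "(F, S, T) \<in> configs P \<Longrightarrow> (F, T, S) \<in> configs P"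
  unfolding configs_def by (simp add: Int_commute)

text \<open>An upward step from \<open>S\<close> stays inside the filter
  \<open>F \<union> S\<close>, which misses \<open>T\<close>, and symmetrically.\<close>

lemma configs_apart:
  assumes "(F, S, T) \<in> configs P" "x \<in> S" "y \<in> T"
  shows "\<not> comparable x y"
proof
  note c = configsD[OF assms(1)]
  assume "comparable x y"
  then consider "x \<le> y" | "y \<le> x"
    by (auto simp: comparable_def)
  then show False
  proof cases
    case 1
    then have "y \<in> F \<union> S"
      using c(2,12) assms(2,3) unfolding filter_in_def by blast
    then show False using c(5,6) assms(3) by blast
  next
    case 2
    then have "x \<in> F \<union> T"
      using c(3,11) assms(2,3) unfolding filter_in_def by blast
    then show False using c(4,6) assms(2) by blast
  qed
qed

lemma squareI:
  assumes "parallelogram A B C D" "convex hull (chi ` {A, B, C, D}) face_of S"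
  shows "{A, B, C, D} \<in> square_sets S"
  unfolding square_sets_def by (rule CollectI, (rule exI)+, rule conjI[OF refl conjI[OF assms]])

lemma squareE:
  assumes "X \<in> square_sets S"
  obtains A B C D where "X = {A, B, C, D}" "parallelogram A B C D"
    "convex hull (chi ` {A, B, C, D}) face_of S"
  using assms unfolding square_sets_def by (elim CollectE exE conjE) (rule that)

lemma chi_in_square_face:
  assumes "convex hull (chi ` X) face_of S" "A \<in> X"
  shows "chi A \<in> S"
  using face_of_imp_subset[OF assms(1)] assms(2) by (meson hull_inc imageI subsetD)

definition order_square :: "'a set \<times> 'a set \<times> 'a set \<Rightarrow> 'a set set" where
  "order_square = (\<lambda>(F, S, T). {F, F \<union> S, F \<union> T, F \<union> S \<union> T})"

text \<open>The supporting equations are \<open>x = 1\<close> on \<open>F\<close>,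
  \<open>x = 0\<close> outside \<open>F \<union> S \<union> T\<close>, and equality along comparable
  pairs inside \<open>S\<close> or inside \<open>T\<close>. By connectedness a solution is constant
  on \<open>S\<close> and on \<open>T\<close>, and these two constants are its coordinates in the
  square.\<close>

lemma order_square_in:
  fixes P :: "'a::{finite,order} set"
  assumes \<omega>: "(F, S, T) \<in> configs P"
  shows "order_square (F, S, T) \<in> square_sets (order_polytope P)"
proof -
  note c = configsD[OF \<omega>]
  define \<Phi> :: "((real ^ 'a::{finite,order} \<Rightarrow> real) \<times> real) set" where
    "\<Phi> = (\<lambda>p. (\<lambda>x. x $ p, 1)) ` F \<union> (\<lambda>p. (\<lambda>x. - x $ p, 0)) ` (- (F \<union> S \<union> T))
      \<union> (\<lambda>(p, q). (\<lambda>x. x $ p - x $ q, 0)) ` {(p, q). p \<le> q \<and> (p \<in> S \<and> q \<in> S \<or> p \<in> T \<and> q \<in> T)}"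
  define face where "face = {x \<in> order_polytope P. \<forall>(f, c)\<in>\<Phi>. f x = c}"
  have face_iff: "x \<in> face \<longleftrightarrow> x \<in> order_polytope P \<and> (\<forall>p\<in>F. x $ p = 1)
      \<and> (\<forall>p\<in>- (F \<union> S \<union> T). x $ p = 0)
      \<and> (\<forall>(p, q)\<in>{(p, q). p \<le> q \<and> (p \<in> S \<and> q \<in> S \<or> p \<in> T \<and> q \<in> T)}. x $ p = x $ q)" for x
    unfolding face_def \<Phi>_def mem_Collect_eq ball_Un ball_simps(9) case_prod_beta by simp
  have face: "face face_of order_polytope P"
    unfolding face_def
  proof (rule face_of_equations[OF convex_order_polytope])
    show "linear f" if "(f, b) \<in> \<Phi>" for f b
      using that unfolding \<Phi>_def by (auto simp: linear_iff algebra_simps)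
    show "f x \<le> b" if "(f, b) \<in> \<Phi>" "x \<in> order_polytope P" for f b x
    proof -
      have "0 \<le> x $ p" "x $ p \<le> 1" for p
        using that(2) order_polytope_subset_cube by (auto simp: mem_box_cart subset_iff)
      moreover have "x $ p \<le> x $ q" if "p \<le> q" "p \<in> P" "q \<in> P" for p q
        using that \<open>x \<in> order_polytope P\<close> by (auto simp: order_polytope_def)
      ultimately show ?thesis
        using that(1) c(11,12) unfolding \<Phi>_def by (auto simp: subset_iff)
    qed
  qed
  have "chi A \<in> face" if "A \<in> {F, F \<union> S, F \<union> T, F \<union> S \<union> T}" for A
  proof -
    have "filter_in P A"
      using that c(1,2,3,9) by blast
    moreover have "A \<inter> S = {} \<or> S \<subseteq> A" "A \<inter> T = {} \<or> T \<subseteq> A"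
      using that c(4,5,6) by blast+
    moreover have "F \<subseteq> A" "A \<subseteq> F \<union> S \<union> T"
      using that by blast+
    ultimately show ?thesis
      unfolding face_iff chi_in_order_polytope_iff by (auto 0 3 simp: of_bool_def)
  qed
  then have 1: "convex hull (chi ` {F, F \<union> S, F \<union> T, F \<union> S \<union> T}) \<subseteq> face"
    by (intro hull_minimal face_of_imp_convex[OF face]) blast
  have 2: "x \<in> convex hull (chi ` {F, F \<union> S, F \<union> T, F \<union> S \<union> T})" if "x \<in> face" for x
  proof -
    have x: "x \<in> order_polytope P" "\<And>p. p \<in> F \<Longrightarrow> x $ p = 1" "\<And>p. p \<notin> F \<union> S \<union> T \<Longrightarrow> x $ p = 0"
      and xS: "\<And>p q. comparable p q \<Longrightarrow> p \<in> S \<Longrightarrow> q \<in> S \<Longrightarrow> x $ p = x $ q"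
      and xT: "\<And>p q. comparable p q \<Longrightarrow> p \<in> T \<Longrightarrow> q \<in> T \<Longrightarrow> x $ p = x $ q"
      using that unfolding face_iff comparable_def by auto metis+
    have bounds: "0 \<le> x $ p" "x $ p \<le> 1" for p
      using x(1) order_polytope_subset_cube by (auto simp: mem_box_cart subset_iff)
    obtain s0 t0 where st0: "s0 \<in> S" "t0 \<in> T"
      using c(7,8) conn_nonempty by blast
    have s: "x $ p = x $ s0" if "p \<in> S" for p
      using c(7) st0(1) that by (rule conn_induct) (auto dest: xS)
    have t: "x $ p = x $ t0" if "p \<in> T" for p
      using c(8) st0(2) that by (rule conn_induct) (auto dest: xT)
    let ?s = "x $ s0" and ?t = "x $ t0"
    \<comment> \<open>The weight of a corner is a product with factor \<open>?s\<close> or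
      \<open>1 - ?s\<close> according to whether it contains \<open>S\<close>, and \<open>?t\<close>
      or \<open>1 - ?t\<close> according to whether it contains \<open>T\<close>.\<close>
    have "x = (?s * ?t) *\<^sub>R chi (F \<union> S \<union> T) + ((1 - ?s) * ?t) *\<^sub>R chi (F \<union> T)
        + (?s * (1 - ?t)) *\<^sub>R chi (F \<union> S) + ((1 - ?s) * (1 - ?t)) *\<^sub>R chi F" (is "_ = ?y")
    proof -
      have "x $ p = ?y $ p" for p
      proof -
        consider "p \<in> F" "p \<notin> S" "p \<notin> T" | "p \<in> S" "p \<notin> F" "p \<notin> T"
          | "p \<in> T" "p \<notin> F" "p \<notin> S" | "p \<notin> F \<union> S \<union> T"
          using c(4,5,6) by blast
        then show ?thesis
          using x(2,3)[of p] s[of p] t[of p] by cases (auto simp: algebra_simps)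
      qed
      then show ?thesis unfolding vec_eq_iff by blast
    qed
    also have "\<dots> \<in> convex hull {chi (F \<union> S \<union> T), chi (F \<union> T), chi (F \<union> S), chi F}"
      by (intro bilinear_in_hull bounds)
    also have "{chi (F \<union> S \<union> T), chi (F \<union> T), chi (F \<union> S), chi F} = chi ` {F, F \<union> S, F \<union> T, F \<union> S \<union> T}"
      by (simp add: insert_commute)
    finally show ?thesis .
  qed
  have "convex hull (chi ` {F, F \<union> S, F \<union> T, F \<union> S \<union> T}) face_of order_polytope P"
    using 1 2 face by (metis subsetI subset_antisym)
  moreover have "parallelogram F (F \<union> S) (F \<union> T) (F \<union> S \<union> T)"
    using c(4,5,6) conn_nonempty[OF c(7)] conn_nonempty[OF c(8)] unfolding parallelogram_def by blast
  ultimately show ?thesis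
    by (simp only: order_square_def prod.case squareI)
qed

lemma parallelogram_swap: "parallelogram A B C D \<Longrightarrow> parallelogram A C B D"
  unfolding parallelogram_def by (simp add: Int_commute Un_commute)

text \<open>For \<open>E\<close> closed under comparability in \<open>B - A\<close>, moving
  \<open>E\<close> from \<open>D\<close> to \<open>A\<close> yields two filters with the same
  intersection and union. Then \<open>A \<union> E\<close> must be a corner, and being inside
  \<open>B\<close> and larger than \<open>A\<close> it can only be \<open>B\<close>.\<close>

lemma order_square_conn:
  assumes face: "convex hull (chi ` {A, B, C, D}) face_of order_polytope P"
    and par: "parallelogram A B C D" and "A \<subseteq> D"
  shows "conn (B - A)"
proof (rule connI)
  have par': "A = B \<inter> C" "D = B \<union> C" "A \<noteq> B" "A \<noteq> C"
    using par \<open>A \<subseteq> D\<close> unfolding parallelogram_def by blast+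
  then show "B - A \<noteq> {}"
    by blast
  have filt: "filter_in P A" "filter_in P B" "filter_in P C" "filter_in P D"
    using chi_in_square_face[OF face] unfolding chi_in_order_polytope_iff by auto
  fix E assume E: "E \<subseteq> B - A" "E \<noteq> {}"
    and closed: "\<And>x y. x \<in> E \<Longrightarrow> y \<in> B - A \<Longrightarrow> comparable x y \<Longrightarrow> y \<in> E"
  have "filter_in P (A \<union> E)"
    unfolding filter_in_def
  proof (intro conjI ballI impI)
    show "A \<union> E \<subseteq> P"
      using filt(1,2) E(1) by (auto simp: filter_in_def)
    fix x y assume xy: "x \<in> A \<union> E" "y \<in> P" "x \<le> y"
    show "y \<in> A \<union> E"
    proof (cases "y \<in> A")
      case False
      then have "x \<in> E"
        using filt(1) xy by (auto simp: filter_in_def)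
      moreover from this have "y \<in> B"
        using filt(2) E(1) xy by (auto simp: filter_in_def)
      ultimately show ?thesis
        using closed[of x y] False xy(3) by (simp add: comparable_def)
    qed simp
  qed
  moreover have "filter_in P (D - E)"
    unfolding filter_in_def
  proof (intro conjI ballI impI)
    show "D - E \<subseteq> P"
      using filt(4) by (auto simp: filter_in_def)
    fix x y assume xy: "x \<in> D - E" "y \<in> P" "x \<le> y"
    have "y \<in> D"
      using xy filt(4) by (auto simp: filter_in_def)
    \<comment> \<open>An \<open>x\<close> in \<open>B\<close> below \<open>y\<close> would itself be
      in \<open>E\<close> by closure; an \<open>x\<close> in \<open>C\<close> would drag
      \<open>y\<close> into \<open>B \<inter> C\<close>, which is \<open>A\<close>.\<close>
    moreover have False if "y \<in> E"
    proof (cases "x \<in> B")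
      case True
      have "x \<notin> A"
        using filt(1) xy E(1) that unfolding filter_in_def by blast
      then show False
        using closed[OF that, of x] True xy by (auto simp: comparable_def)
    next
      case False
      then have "y \<in> C"
        using xy filt(3) par'(2) unfolding filter_in_def by blast
      with that E(1) par'(1) show False by blast
    qed
    ultimately show "y \<in> D - E" by blast
  qed
  moreover have "(A \<union> E) \<inter> (D - E) = A \<inter> D" "(A \<union> E) \<union> (D - E) = A \<union> D"
    using E(1) par' by blast+
  ultimately have "A \<union> E \<in> {A, B, C, D}"
    by (intro square_face_closed[OF face parallelogram_distinct(3)[OF par], of _ "D - E"])
      (simp_all only: chi_in_order_polytope_iff)
  then consider "A \<union> E = A" | "A \<union> E = B" | "A \<union> E = C" | "A \<union> E = D"
    by blast
  then show "E = B - A"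
  proof cases
    case 2
    then show ?thesis using E(1) by blast
  qed (use E par' in blast)+
qed

text \<open>Filters are closed under intersection and union, so \<open>A \<inter> D\<close> and
  \<open>A \<union> D\<close> have the same midpoint as \<open>A\<close> and \<open>D\<close>. Hence
  \<open>A \<inter> D\<close> is itself a corner, and the square can be relabelled to start from its
  least corner.\<close>

lemma order_square_surj:
  assumes "X \<in> square_sets (order_polytope P)"
  shows "X \<in> order_square ` configs P"
proof -
  obtain A B C D where X: "X = {A, B, C, D}" and par: "parallelogram A B C D"
    and face: "convex hull (chi ` {A, B, C, D}) face_of order_polytope P"
    using assms by (rule squareE)
  have "filter_in P A" "filter_in P D"
    using chi_in_square_face[OF face] unfolding chi_in_order_polytope_iff by auto
  then have "filter_in P (A \<inter> D)" "filter_in P (A \<union> D)"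
    by (auto simp: filter_in_def)
  then have "A \<inter> D \<in> {A, B, C, D}"
    by (intro square_face_closed[OF face parallelogram_distinct(3)[OF par], of "A \<inter> D" "A \<union> D"])
      (auto simp: chi_in_order_polytope_iff)
  \<comment> \<open>One relabelling for each corner other than \<open>A\<close> that may turn out to
    be \<open>A \<inter> D\<close>.\<close>
  moreover have perms: "{D, B, C, A} = X" "{B, A, D, C} = X" "{C, A, D, B} = X"
    unfolding X by blast+
  moreover have "parallelogram D B C A" "parallelogram B A D C" "parallelogram C A D B"
    using par parallelogram_distinct[OF par] unfolding parallelogram_def
    by (metis Int_commute Un_commute)+
  moreover have "A \<inter> D = B \<inter> C"
    using par by (simp add: parallelogram_def)
  ultimately have "\<exists>A B C D. X = {A, B, C, D} \<and> parallelogram A B C D \<and> A \<subseteq> D"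
    using X par by (metis (no_types, lifting) inf.absorb_iff1 inf_commute insertE singletonD)
  then obtain A B C D where X: "X = {A, B, C, D}" and par: "parallelogram A B C D" and "A \<subseteq> D"
    by blast
  have face: "convex hull (chi ` {A, B, C, D}) face_of order_polytope P"
    using assms X squareE[OF assms] by metis
  have filt: "filter_in P A" "filter_in P B" "filter_in P C" "filter_in P D"
    using chi_in_square_face[OF face] unfolding chi_in_order_polytope_iff by auto
  have par': "A = B \<inter> C" "D = B \<union> C"
    using par \<open>A \<subseteq> D\<close> unfolding parallelogram_def by blast+
  then have eqs: "A \<union> (B - A) = B" "A \<union> (C - A) = C" "B \<union> (C - A) = D"
    by blast+
  have "conn (B - A)"
    by (rule order_square_conn[OF face par \<open>A \<subseteq> D\<close>])
  moreover have "conn (C - A)"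
    by (rule order_square_conn[OF _ parallelogram_swap[OF par] \<open>A \<subseteq> D\<close>])
      (use face in \<open>simp only: insert_commute\<close>)
  ultimately have "(A, B - A, C - A) \<in> configs P"
    unfolding configs_def mem_Collect_eq prod.case eqs using filt par' by blast
  moreover have "X = order_square (A, B - A, C - A)"
    unfolding order_square_def prod.case eqs X ..
  ultimately show ?thesis by blast
qed

text \<open>Intersection and union of the corners return \<open>F\<close> and
  \<open>F \<union> S \<union> T\<close>; the corner \<open>F \<union> S\<close> must then be one of
  the two middle corners of the other square.\<close>

lemma order_square_eq_iff:
  assumes \<omega>: "(F, S, T) \<in> configs P" and \<omega>': "(F', S', T') \<in> configs P"
  shows "order_square (F, S, T) = order_square (F', S', T') \<longleftrightarrow>
    F = F' \<and> (S = S' \<and> T = T' \<or> S = T' \<and> T = S')"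
proof
  note c = configsD[OF \<omega>] and c' = configsD[OF \<omega>']
  note ne = conn_nonempty[OF c(7)] conn_nonempty[OF c(8)]
  assume eq: "order_square (F, S, T) = order_square (F', S', T')"
  have Inter: "\<Inter> (order_square (F, S, T)) = F" and Union: "\<Union> (order_square (F, S, T)) = F \<union> S \<union> T"
    for F S T :: "'a set"
    by (auto simp: order_square_def)
  have F: "F = F'"
    using Inter[of F S T] Inter[of F' S' T'] eq by simp
  have "S \<union> T = \<Union> (order_square (F, S, T)) - F" "S' \<union> T' = \<Union> (order_square (F', S', T')) - F'"
    unfolding Union using c(4,5) c'(4,5) by blast+
  then have un: "S \<union> T = S' \<union> T'"
    using eq F by simp
  have "F \<union> S \<in> order_square (F', S', T')"
    unfolding eq[symmetric] by (simp add: order_square_def)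
  then consider "F \<union> S = F" | "F \<union> S = F \<union> S'" | "F \<union> S = F \<union> T'" | "F \<union> S = F \<union> S \<union> T"
    using F un by (auto simp: order_square_def Un_assoc)
  then have "S = S' \<or> S = T'"
  proof cases
    case 1 then show ?thesis using ne c(4) by blast
  next
    case 2 then show ?thesis using F c(4) c'(4) by blast
  next
    case 3 then show ?thesis using F c(4) c'(5) by blast
  next
    case 4 then show ?thesis using ne c(5,6) by blast
  qed
  then show "F = F' \<and> (S = S' \<and> T = T' \<or> S = T' \<and> T = S')"
    using F un c(6) c'(6) by blast
qed (auto simp: order_square_def)

subsection \<open>Square faces of the chain polytope\<close>

definition lows :: "'a::order set \<Rightarrow> 'a set" where
  "lows S = {x \<in> S. \<forall>y\<in>S. \<not> y < x}"

text \<open>A one-element \<open>S\<close> is switched against the empty set, hence the difference.\<close>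

definition highs :: "'a::order set \<Rightarrow> 'a set" where
  "highs S = {x \<in> S. \<forall>y\<in>S. \<not> x < y} - lows S"

text \<open>The antichain \<open>core F S\<close> generates the part of the filter \<open>F\<close> that \<open>S\<close> does not determine.\<close>

definition core :: "'a::order set \<Rightarrow> 'a set \<Rightarrow> 'a set" where
  "core F S = lows {p \<in> F. \<forall>s\<in>S. \<not> comparable s p}"

text \<open>The order-convex hull within \<open>P\<close>; it recovers a piece from its extremal
  elements, which are all that a chain square shows.\<close>

definition order_hull :: "'a::order set \<Rightarrow> 'a set \<Rightarrow> 'a set" where
  "order_hull P K = {p \<in> P. \<exists>k\<in>K. \<exists>k'\<in>K. k \<le> p \<and> p \<le> k'}"

lemma lows_subset: "lows S \<subseteq> S" and highs_subset: "highs S \<subseteq> S"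
  and lows_highs_disjoint: "lows S \<inter> highs S = {}"
  by (auto simp: lows_def highs_def)

lemma lows_antichain: "x \<in> lows S \<Longrightarrow> y \<in> lows S \<Longrightarrow> \<not> x < y"
  by (simp add: lows_def)

lemma highs_antichain: "x \<in> highs S \<Longrightarrow> y \<in> highs S \<Longrightarrow> \<not> x < y"
  by (simp add: highs_def)

lemma lows_below:
  fixes S :: "'a::{finite,order} set"
  assumes "s \<in> S"
  obtains l where "l \<in> lows S" "l \<le> s"
proof -
  obtain l where "l \<in> S" "l \<le> s" "\<forall>b\<in>S. b \<le> l \<longrightarrow> l = b"
    using finite_has_minimal2[of S s] assms by auto
  moreover from this have "l \<in> lows S"
    by (auto simp: lows_def less_le)
  ultimately show ?thesis
    using that by blast
qed

text \<open>A maximal element that is also minimal is counted in \<open>lows\<close> only, hence the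
  union.\<close>

lemma ends_above:
  fixes S :: "'a::{finite,order} set"
  assumes "s \<in> S"
  obtains u where "u \<in> lows S \<union> highs S" "s \<le> u"
proof -
  obtain u where "u \<in> S" "s \<le> u" "\<forall>b\<in>S. u \<le> b \<longrightarrow> u = b"
    using finite_has_maximal2[of S s] assms by auto
  moreover from this have "u \<in> lows S \<union> highs S"
    by (auto simp: highs_def less_le)
  ultimately show ?thesis
    using that by blast
qed

text \<open>A walk through \<open>S\<close> is shadowed by extremal elements: each point visited
  stays comparable to some member of the closed set \<open>E\<close>, and applied to an extremal
  point this puts the point itself into \<open>E\<close>.\<close>

lemma conn_ends:
  fixes S :: "'a::{finite,order} set"
  assumes S: "conn S"
  shows "conn (lows S \<union> highs S)"
proof (rule connI)
  obtain s where "s \<in> S"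
    using conn_nonempty[OF S] by auto
  then show "lows S \<union> highs S \<noteq> {}"
    using lows_below by (metis empty_iff Un_empty)
  fix E assume E: "E \<subseteq> lows S \<union> highs S" "E \<noteq> {}"
    and closed: "\<And>x y. x \<in> E \<Longrightarrow> y \<in> lows S \<union> highs S \<Longrightarrow> comparable x y \<Longrightarrow> y \<in> E"
  obtain e where "e \<in> E"
    using E(2) by auto
  then have "e \<in> S"
    using E(1) lows_subset highs_subset by blast
  have near: "\<exists>k\<in>E. comparable w k" if "w \<in> S" for w
    using S \<open>e \<in> S\<close> that
  proof (rule conn_induct)
    show "\<exists>k\<in>E. comparable e k"
      using \<open>e \<in> E\<close> by (auto simp: comparable_def)
    fix y z assume yz: "y \<in> S" "z \<in> S" "comparable y z" "\<exists>k\<in>E. comparable y k"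
    then obtain k where k: "k \<in> E" "comparable y k"
      by auto
    obtain l where l: "l \<in> lows S" "l \<le> y"
      using yz(1) by (rule lows_below)
    obtain u where u: "u \<in> lows S \<union> highs S" "y \<le> u"
      using yz(1) by (rule ends_above)
    \<comment> \<open>If \<open>k\<close> is below \<open>y\<close>, an extremal \<open>u\<close>
      above \<open>y\<close> is above \<open>k\<close> and so in \<open>E\<close>. A neighbour
      \<open>z\<close> of \<open>y\<close> is then above \<open>k\<close> or below \<open>u\<close>.
      The other case is dual and uses \<open>l\<close>.\<close>
    from k(2) consider "k \<le> y" | "y \<le> k"
      by (auto simp: comparable_def)
    then show "\<exists>k\<in>E. comparable z k"
    proof cases
      case 1
      then have "u \<in> E"
        using closed[OF k(1) u(1)] order_trans[OF 1 u(2)] by (simp add: comparable_def)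
      then show ?thesis
        using yz(3) 1 u(2) k(1) unfolding comparable_def by (meson order_trans)
    next
      case 2
      then have "l \<in> E"
        using closed[OF k(1), of l] l(1) order_trans[OF l(2) 2] by (simp add: comparable_def)
      then show ?thesis
        using yz(3) 2 l(2) k(1) unfolding comparable_def by (meson order_trans)
    qed
  qed
  show "E = lows S \<union> highs S"
  proof
    show "lows S \<union> highs S \<subseteq> E"
    proof
      fix x assume x: "x \<in> lows S \<union> highs S"
      then have "x \<in> S"
        using lows_subset highs_subset by blast
      then obtain k where "k \<in> E" "comparable x k"
        using near by auto
      then show "x \<in> E"
        using closed x comparable_sym by metis
    qed
  qed (rule E(1))
qed

section \<open>Configurations give faces of the chain polytope\<close>

text \<open>Chains of at most two elements supply the equations: \<open>x = 1\<close> on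
  \<open>M\<close>, \<open>x = 0\<close> off all the sets, and \<open>x $ p + x $ q = 1\<close> for
  comparable \<open>p\<close> and \<open>q\<close> on the two sides of one piece. Each connected
  piece then keeps one degree of freedom.\<close>

lemma chain_face:
  fixes P :: "'a::{finite,order} set"
  assumes anti: "antichain_in P (M \<union> L1 \<union> L2)" "antichain_in P (M \<union> H1 \<union> L2)"
      "antichain_in P (M \<union> L1 \<union> H2)" "antichain_in P (M \<union> H1 \<union> H2)"
    and disj: "L1 \<inter> H1 = {}" "L2 \<inter> H2 = {}" "(L1 \<union> H1) \<inter> (L2 \<union> H2) = {}"
      "M \<inter> (L1 \<union> H1) = {}" "M \<inter> (L2 \<union> H2) = {}"
    and conn: "conn (L1 \<union> H1)" "conn (L2 \<union> H2)"
  shows "convex hull (chi ` {M \<union> L1 \<union> L2, M \<union> H1 \<union> L2, M \<union> L1 \<union> H2, M \<union> H1 \<union> H2})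
    face_of chain_polytope P"
proof -
  let ?X = "{M \<union> L1 \<union> L2, M \<union> H1 \<union> L2, M \<union> L1 \<union> H2, M \<union> H1 \<union> H2}"
  let ?U = "M \<union> (L1 \<union> H1) \<union> (L2 \<union> H2)"
  define pairs where "pairs = {(p, q). comparable p q \<and> (p \<in> L1 \<and> q \<in> H1 \<or> p \<in> L2 \<and> q \<in> H2)}"
  define \<Phi> :: "((real ^ 'a::{finite,order} \<Rightarrow> real) \<times> real) set" where
    "\<Phi> = (\<lambda>p. (\<lambda>x. x $ p, 1)) ` M \<union> (\<lambda>p. (\<lambda>x. - x $ p, 0)) ` (- ?U)
      \<union> (\<lambda>(p, q). (\<lambda>x. x $ p + x $ q, 1)) ` pairs"
  define face where "face = {x \<in> chain_polytope P. \<forall>(f, c)\<in>\<Phi>. f x = c}"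
  have face_iff: "x \<in> face \<longleftrightarrow> x \<in> chain_polytope P \<and> (\<forall>p\<in>M. x $ p = 1)
      \<and> (\<forall>p\<in>- ?U. x $ p = 0) \<and> (\<forall>(p, q)\<in>pairs. x $ p + x $ q = 1)" for x
    unfolding face_def \<Phi>_def mem_Collect_eq ball_Un ball_simps(9) case_prod_beta by simp
  have subsets: "L1 \<subseteq> P" "H1 \<subseteq> P" "L2 \<subseteq> P" "H2 \<subseteq> P"
    using anti unfolding antichain_in_def by auto
  have pairs_less: "p \<in> P \<and> q \<in> P \<and> (p < q \<or> q < p)" if "(p, q) \<in> pairs" for p q
    using that subsets disj unfolding pairs_def comparable_def by (auto simp: le_less)
  have face: "face face_of chain_polytope P"
    unfolding face_def
  proof (rule face_of_equations[OF convex_chain_polytope])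
    show "linear f" if "(f, b) \<in> \<Phi>" for f b
      using that unfolding \<Phi>_def by (auto simp: linear_iff algebra_simps)
    show "f x \<le> b" if "(f, b) \<in> \<Phi>" "x \<in> chain_polytope P" for f b x
    proof -
      note x = chain_polytopeD[OF that(2)]
      have "x $ p + x $ q \<le> 1" if "(p, q) \<in> pairs" for p q
        using pairs_less[OF that] x(4)[of p q] x(4)[of q p] by (auto simp: add.commute)
      then show ?thesis
        using that(1) x(2,3) unfolding \<Phi>_def by auto
    qed
  qed
  have "chi A \<in> face" if "A \<in> ?X" for A
  proof -
    have "antichain_in P A"
      using that anti by auto
    moreover have "M \<subseteq> A" "A \<subseteq> ?U"
      using that by auto
    moreover have "p \<in> A \<longleftrightarrow> q \<notin> A" if "(p, q) \<in> pairs" for p q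
      using that \<open>A \<in> ?X\<close> disj unfolding pairs_def by auto
    ultimately show ?thesis
      unfolding face_iff chi_in_chain_polytope_iff by (auto simp: of_bool_def)
  qed
  then have 1: "convex hull (chi ` ?X) \<subseteq> face"
    by (intro hull_minimal face_of_imp_convex[OF face]) blast
  have 2: "x \<in> convex hull (chi ` ?X)" if "x \<in> face" for x
  proof -
    have x: "x \<in> chain_polytope P" "\<And>p. p \<in> M \<Longrightarrow> x $ p = 1" "\<And>p. p \<notin> ?U \<Longrightarrow> x $ p = 0"
      and xp: "\<And>p q. (p, q) \<in> pairs \<Longrightarrow> x $ p + x $ q = 1"
      using that unfolding face_iff by auto
    have ex: "\<exists>s. 0 \<le> s \<and> s \<le> 1 \<and> (\<forall>p\<in>L. x $ p = s) \<and> (\<forall>p\<in>H. x $ p = 1 - s)"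
      if "conn (L \<union> H)" "antichain_in P L" "antichain_in P H" "L \<inter> H = {}"
        and pairs: "\<And>p q. p \<in> L \<Longrightarrow> q \<in> H \<Longrightarrow> comparable p q \<Longrightarrow> x $ p + x $ q = 1" for L H
    proof -
      \<comment> \<open>Complementing the values on \<open>H\<close> turns the equations across the
        two sides into equalities, so \<open>v\<close> is constant along comparabilities.\<close>
      define v where "v p = (if p \<in> L then x $ p else 1 - x $ p)" for p
      obtain e where e: "e \<in> L \<union> H"
        using conn_nonempty[OF \<open>conn (L \<union> H)\<close>] by auto
      have v: "v p = v e" if "p \<in> L \<union> H" for p
        using \<open>conn (L \<union> H)\<close> e that
      proof (rule conn_induct)
        fix y z assume yz: "y \<in> L \<union> H" "z \<in> L \<union> H" "comparable y z" "v y = v e"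
        have lt: "y < z \<or> z < y \<or> y = z"
          using yz(3) by (auto simp: comparable_def le_less)
        have "y = z" if "y \<in> L \<and> z \<in> L \<or> y \<in> H \<and> z \<in> H"
          using that lt \<open>antichain_in P L\<close> \<open>antichain_in P H\<close> by (auto simp: antichain_in_def)
        moreover have "v y = v z" if "y \<in> L" "z \<in> H"
          using pairs[OF that yz(3)] that \<open>L \<inter> H = {}\<close> by (auto simp: v_def)
        moreover have "v y = v z" if "y \<in> H" "z \<in> L"
          using pairs[OF that(2,1)] yz(3) that \<open>L \<inter> H = {}\<close> by (auto simp: v_def comparable_sym)
        ultimately show "v z = v e"
          using yz by auto
      qed simp
      have "0 \<le> v e" "v e \<le> 1"
        using chain_polytopeD(2,3)[OF x(1), of e] by (auto simp: v_def)
      moreover have "x $ p = v e" if "p \<in> L" for p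
        using v[of p] that unfolding v_def[of p] by simp
      moreover have "x $ p = 1 - v e" if "p \<in> H" for p
      proof -
        have "p \<notin> L"
          using that \<open>L \<inter> H = {}\<close> by auto
        then show ?thesis
          using v[of p] that unfolding v_def[of p] by simp
      qed
      ultimately show ?thesis by blast
    qed
    have sub: "antichain_in P L1" "antichain_in P H1" "antichain_in P L2" "antichain_in P H2"
      using anti unfolding antichain_in_def by auto
    obtain s where s: "0 \<le> s" "s \<le> 1" "\<And>p. p \<in> L1 \<Longrightarrow> x $ p = s" "\<And>p. p \<in> H1 \<Longrightarrow> x $ p = 1 - s"
      using ex[OF conn(1) sub(1,2) disj(1)] xp unfolding pairs_def by auto
    obtain t where t: "0 \<le> t" "t \<le> 1" "\<And>p. p \<in> L2 \<Longrightarrow> x $ p = t" "\<And>p. p \<in> H2 \<Longrightarrow> x $ p = 1 - t"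
      using ex[OF conn(2) sub(3,4) disj(2)] xp unfolding pairs_def by auto
    have "x = (s * t) *\<^sub>R chi (M \<union> L1 \<union> L2) + ((1 - s) * t) *\<^sub>R chi (M \<union> H1 \<union> L2)
        + (s * (1 - t)) *\<^sub>R chi (M \<union> L1 \<union> H2) + ((1 - s) * (1 - t)) *\<^sub>R chi (M \<union> H1 \<union> H2)"
      (is "_ = ?y")
    proof -
      have "x $ p = ?y $ p" for p
      proof -
        consider "p \<in> M" "p \<notin> L1" "p \<notin> H1" "p \<notin> L2" "p \<notin> H2"
          | "p \<notin> M" "p \<in> L1" "p \<notin> H1" "p \<notin> L2" "p \<notin> H2"
          | "p \<notin> M" "p \<notin> L1" "p \<in> H1" "p \<notin> L2" "p \<notin> H2"
          | "p \<notin> M" "p \<notin> L1" "p \<notin> H1" "p \<in> L2" "p \<notin> H2"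
          | "p \<notin> M" "p \<notin> L1" "p \<notin> H1" "p \<notin> L2" "p \<in> H2"
          | "p \<notin> ?U"
          using disj by blast
        then show ?thesis
          using x(2,3)[of p] s(3,4)[of p] t(3,4)[of p] by cases (auto simp: algebra_simps)
      qed
      then show ?thesis unfolding vec_eq_iff by blast
    qed
    also have "\<dots> \<in> convex hull {chi (M \<union> L1 \<union> L2), chi (M \<union> H1 \<union> L2), chi (M \<union> L1 \<union> H2), chi (M \<union> H1 \<union> H2)}"
      by (intro bilinear_in_hull s t)
    finally show ?thesis by simp
  qed
  show ?thesis
    using 1 2 face by (metis subsetI subset_antisym)
qed

definition chain_square :: "'a::order set \<times> 'a set \<times> 'a set \<Rightarrow> 'a set set" where
  "chain_square = (\<lambda>(F, S, T). let M = core F (S \<union> T) in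
     {M \<union> lows S \<union> lows T, M \<union> highs S \<union> lows T, M \<union> lows S \<union> highs T, M \<union> highs S \<union> highs T})"

lemma core_facts:
  assumes "p \<in> core F S"
  shows "p \<in> F" "s \<in> S \<Longrightarrow> \<not> comparable s p" "s \<in> S \<Longrightarrow> \<not> comparable p s" "q \<in> core F S \<Longrightarrow> \<not> p < q"
  using assms lows_antichain unfolding core_def by (auto simp: lows_def comparable_def)

lemma antichain_Un3:
  assumes "A \<subseteq> P" "B \<subseteq> P" "C \<subseteq> P"
    and "\<And>x y. x \<in> A \<Longrightarrow> y \<in> A \<Longrightarrow> \<not> x < y" "\<And>x y. x \<in> B \<Longrightarrow> y \<in> B \<Longrightarrow> \<not> x < y"
      "\<And>x y. x \<in> C \<Longrightarrow> y \<in> C \<Longrightarrow> \<not> x < y"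
    and "\<And>x y. x \<in> A \<Longrightarrow> y \<in> B \<Longrightarrow> \<not> comparable x y" "\<And>x y. x \<in> A \<Longrightarrow> y \<in> C \<Longrightarrow> \<not> comparable x y"
      "\<And>x y. x \<in> B \<Longrightarrow> y \<in> C \<Longrightarrow> \<not> comparable x y"
  shows "antichain_in P (A \<union> B \<union> C)"
  unfolding antichain_in_def
proof (intro conjI ballI notI)
  fix x y assume xy: "x \<in> A \<union> B \<union> C" "y \<in> A \<union> B \<union> C" "x < y"
  then have "comparable x y" "comparable y x"
    by (auto simp: comparable_def)
  with assms(4-9) xy show False
    by auto
qed (use assms(1-3) in auto)

lemma lows_nonempty: "conn S \<Longrightarrow> lows (S :: 'a::{finite,order} set) \<noteq> {}"
  using conn_nonempty lows_below by (metis empty_iff ex_in_conv)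

text \<open>Core, \<open>S\<close> and \<open>T\<close> are mutually incomparable, so any side of
  \<open>S\<close> may be combined with any side of \<open>T\<close>; \<open>conn_ends\<close> makes
  the two pieces connected.\<close>

lemma chain_square_in:
  fixes P :: "'a::{finite,order} set"
  assumes \<omega>: "(F, S, T) \<in> configs P"
  shows "chain_square (F, S, T) \<in> square_sets (chain_polytope P)"
proof -
  note c = configsD[OF \<omega>]
  define M where "M = core F (S \<union> T)"
  have M: "M \<subseteq> P" "\<And>p q. p \<in> M \<Longrightarrow> q \<in> M \<Longrightarrow> \<not> p < q"
      "\<And>p s. p \<in> M \<Longrightarrow> s \<in> S \<Longrightarrow> \<not> comparable p s" "\<And>p s. p \<in> M \<Longrightarrow> s \<in> T \<Longrightarrow> \<not> comparable p s"
    using core_facts[of _ F "S \<union> T"] c(10) unfolding M_def by blast+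
  have MS: "M \<inter> S = {}" "M \<inter> T = {}"
    using M(3,4) by (auto simp: comparable_def)
  note sub = lows_subset[of S] lows_subset[of T] highs_subset[of S] highs_subset[of T]
  have anti: "antichain_in P (M \<union> X \<union> Y)"
    if X: "X \<in> {lows S, highs S}" and Y: "Y \<in> {lows T, highs T}" for X Y
  proof -
    have XY: "X \<subseteq> S" "Y \<subseteq> T"
      using X Y sub by auto
    show ?thesis
    proof (rule antichain_Un3)
      show "\<not> x < y" if "x \<in> X" "y \<in> X" for x y
        using X that lows_antichain highs_antichain by blast
      show "\<not> x < y" if "x \<in> Y" "y \<in> Y" for x y
        using Y that lows_antichain highs_antichain by blast
      show "\<not> comparable x y" if "x \<in> X" "y \<in> Y" for x y
        using configs_apart[OF \<omega>, of x y] that XY by blast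
    qed (use XY M c(11,12) in blast)+
  qed
  have "convex hull (chi ` {M \<union> lows S \<union> lows T, M \<union> highs S \<union> lows T, M \<union> lows S \<union> highs T, M \<union> highs S \<union> highs T})
      face_of chain_polytope P"
  proof (rule chain_face)
    show "lows S \<inter> highs S = {}" "lows T \<inter> highs T = {}"
      by (rule lows_highs_disjoint)+
    show "(lows S \<union> highs S) \<inter> (lows T \<union> highs T) = {}"
      using sub c(6) by blast
    show "M \<inter> (lows S \<union> highs S) = {}" "M \<inter> (lows T \<union> highs T) = {}"
      using sub MS by blast+
  qed (simp_all add: anti conn_ends c)
  moreover have "parallelogram (M \<union> lows S \<union> lows T) (M \<union> highs S \<union> lows T) (M \<union> lows S \<union> highs T) (M \<union> highs S \<union> highs T)"
  proof -
    \<comment> \<open>Witnesses that the corners differ come from \<open>lows\<close>, since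
      \<open>highs\<close> may be empty.\<close>
    obtain s t where st: "s \<in> lows S" "t \<in> lows T"
      using lows_nonempty c(7,8) by blast
    have "s \<notin> M \<union> highs S \<union> lows T" "t \<notin> M \<union> lows S \<union> highs T"
      using st sub MS c(6) lows_highs_disjoint[of S] lows_highs_disjoint[of T] by blast+
    moreover have "lows S \<inter> highs S = {}" "lows T \<inter> highs T = {}" "(lows S \<union> highs S) \<inter> (lows T \<union> highs T) = {}"
      using sub c(6) lows_highs_disjoint by blast+
    ultimately show ?thesis
      using st unfolding parallelogram_def by blast
  qed
  ultimately have "{M \<union> lows S \<union> lows T, M \<union> highs S \<union> lows T, M \<union> lows S \<union> highs T, M \<union> highs S \<union> highs T}
      \<in> square_sets (chain_polytope P)"
    by (intro squareI)
  then show ?thesis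
    by (simp only: chain_square_def prod.case Let_def M_def)
qed

section \<open>Recovering a configuration from its chain square\<close>

text \<open>As the difference of the filters \<open>F \<union> S\<close> and \<open>F\<close>, the
  set \<open>S\<close> is order-convex, and by finiteness each element lies between two extremal
  ones.\<close>

lemma config_order_hull_ends:
  fixes P :: "'a::{finite,order} set"
  assumes \<omega>: "(F, S, T) \<in> configs P"
  shows "order_hull P (lows S \<union> highs S) = S"
proof
  note c = configsD[OF \<omega>]
  show "S \<subseteq> order_hull P (lows S \<union> highs S)"
  proof
    fix s assume s: "s \<in> S"
    obtain l where "l \<in> lows S" "l \<le> s"
      using s by (rule lows_below)
    moreover obtain u where "u \<in> lows S \<union> highs S" "s \<le> u"
      using s by (rule ends_above)
    ultimately show "s \<in> order_hull P (lows S \<union> highs S)"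
      using s c(11) unfolding order_hull_def by blast
  qed
  show "order_hull P (lows S \<union> highs S) \<subseteq> S"
  proof
    fix p assume "p \<in> order_hull P (lows S \<union> highs S)"
    then obtain k k' where k: "k \<in> S" "k' \<in> S" "k \<le> p" "p \<le> k'" "p \<in> P"
      using lows_subset highs_subset unfolding order_hull_def by blast
    have "p \<in> F \<union> S"
      using c(2) k unfolding filter_in_def by blast
    moreover have "p \<notin> F"
      using c(1,4,11) k unfolding filter_in_def by blast
    ultimately show "p \<in> S" by blast
  qed
qed

text \<open>Recovers \<open>F\<close> from \<open>S \<union> T\<close> and the core. An element of
  \<open>F\<close> comparable to some \<open>s\<close> in \<open>S \<union> T\<close> must lie above
  it, since otherwise \<open>s\<close> would be in \<open>F\<close>; all other elements of
  \<open>F\<close> lie above a minimal one of their kind, a core element.\<close>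

lemma config_filter:
  fixes P :: "'a::{finite,order} set"
  assumes \<omega>: "(F, S, T) \<in> configs P"
  shows "F = {p \<in> P. p \<notin> S \<union> T \<and> (\<exists>s\<in>S \<union> T. s \<le> p)} \<union> {p \<in> P. \<exists>m\<in>core F (S \<union> T). m \<le> p}"
    (is "_ = ?A \<union> ?B")
proof
  note c = configsD[OF \<omega>]
  show "F \<subseteq> ?A \<union> ?B"
  proof
    fix p assume p: "p \<in> F"
    show "p \<in> ?A \<union> ?B"
    proof (cases "\<exists>s\<in>S \<union> T. comparable s p")
      case True
      then obtain s where s: "s \<in> S \<union> T" "comparable s p" by blast
      have "\<not> p \<le> s"
        using c(1,4,5,11,12) p s(1) unfolding filter_in_def by blast
      with s c(4,5,10) p show ?thesis
        by (auto simp: comparable_def)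
    next
      case False
      then have "p \<in> {p \<in> F. \<forall>s\<in>S \<union> T. \<not> comparable s p}"
        using p by simp
      then obtain m where "m \<in> core F (S \<union> T)" "m \<le> p"
        unfolding core_def by (rule lows_below)
      then show ?thesis
        using p c(10) by blast
    qed
  qed
  have "?A \<subseteq> F"
    using c(9) unfolding filter_in_def by blast
  moreover have "?B \<subseteq> F"
    using c(1) core_facts(1) unfolding filter_in_def by blast
  ultimately show "?A \<union> ?B \<subseteq> F" by blast
qed

text \<open>\<open>K\<close> and \<open>K'\<close> are components of the same comparability graph
  and share a point.\<close>

lemma conn_component_eq:
  assumes "conn K" "conn K'" "K \<union> L = K' \<union> L'" "x \<in> K" "x \<in> K'"
    and "\<And>x y. x \<in> K \<Longrightarrow> y \<in> L \<Longrightarrow> \<not> comparable x y" "\<And>x y. x \<in> K' \<Longrightarrow> y \<in> L' \<Longrightarrow> \<not> comparable x y"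
  shows "K = K'"
proof -
  have "y \<in> K'" if "x \<in> K'" "y \<in> K" "comparable x y" for x y
    using that assms(3) assms(7)[OF that(1), of y] by blast
  then have "K \<inter> K' = K"
    using assms(4,5) by (intro conn_closed[OF assms(1)]) auto
  have "y \<in> K" if "x \<in> K" "y \<in> K'" "comparable x y" for x y
    using that assms(3) assms(6)[OF that(1), of y] by blast
  then have "K \<inter> K' = K'"
    using assms(4,5) by (intro conn_closed[OF assms(2)]) auto
  with \<open>K \<inter> K' = K\<close> show ?thesis
    by simp
qed

lemma chain_square_Inter_Union:
  fixes P :: "'a::{finite,order} set"
  assumes \<omega>: "(F, S, T) \<in> configs P"
  shows "\<Inter> (chain_square (F, S, T)) = core F (S \<union> T)"
    "\<Union> (chain_square (F, S, T)) - core F (S \<union> T) = (lows S \<union> highs S) \<union> (lows T \<union> highs T)"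
proof -
  have Inter: "\<Inter> {M \<union> L \<union> L', M \<union> H \<union> L', M \<union> L \<union> H', M \<union> H \<union> H'} = M"
    if "L \<inter> H = {}" "L' \<inter> H' = {}" "(L \<union> H) \<inter> (L' \<union> H') = {}" for M L H L' H' :: "'a set"
    using that by auto
  have Union: "\<Union> {M \<union> L \<union> L', M \<union> H \<union> L', M \<union> L \<union> H', M \<union> H \<union> H'} - M = (L \<union> H) \<union> (L' \<union> H')"
    if "M \<inter> ((L \<union> H) \<union> (L' \<union> H')) = {}" for M L H L' H' :: "'a set"
    using that by auto
  have sub: "lows S \<union> highs S \<subseteq> S" "lows T \<union> highs T \<subseteq> T"
    using lows_subset highs_subset by auto
  then have "(lows S \<union> highs S) \<inter> (lows T \<union> highs T) = {}"
    using configsD(6)[OF \<omega>] by blast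
  then show "\<Inter> (chain_square (F, S, T)) = core F (S \<union> T)"
    unfolding chain_square_def Let_def prod.case by (intro Inter lows_highs_disjoint)
  have "core F (S \<union> T) \<inter> (S \<union> T) = {}"
    using core_facts(2)[of _ F "S \<union> T"] by (auto simp: comparable_def)
  then have "core F (S \<union> T) \<inter> ((lows S \<union> highs S) \<union> (lows T \<union> highs T)) = {}"
    using sub by blast
  then show "\<Union> (chain_square (F, S, T)) - core F (S \<union> T) = (lows S \<union> highs S) \<union> (lows T \<union> highs T)"
    unfolding chain_square_def Let_def prod.case by (rule Union)
qed

lemma chain_square_swap: "chain_square (F, S, T) = chain_square (F, T, S)"
  by (auto simp: chain_square_def Let_def Un_ac)

text \<open>The intersection of the corners is the core, and the rest of their union splits into
  components, the ends of \<open>S\<close> and of \<open>T\<close>. Their hulls return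
  \<open>S\<close> and \<open>T\<close>, and \<open>config_filter\<close> returns
  \<open>F\<close>.\<close>

lemma chain_square_eq_iff:
  fixes P :: "'a::{finite,order} set"
  assumes \<omega>: "(F, S, T) \<in> configs P" and \<omega>': "(F', S', T') \<in> configs P"
  shows "chain_square (F, S, T) = chain_square (F', S', T') \<longleftrightarrow>
    F = F' \<and> (S = S' \<and> T = T' \<or> S = T' \<and> T = S')"
proof
  let ?E = "\<lambda>S. lows S \<union> highs S"
  assume eq: "chain_square (F, S, T) = chain_square (F', S', T')"
  have core: "core F (S \<union> T) = core F' (S' \<union> T')"
    using chain_square_Inter_Union(1)[OF \<omega>] chain_square_Inter_Union(1)[OF \<omega>'] eq by simp
  have un: "?E S \<union> ?E T = ?E S' \<union> ?E T'"
    using chain_square_Inter_Union(2)[OF \<omega>] chain_square_Inter_Union(2)[OF \<omega>'] eq core by simp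
  \<comment> \<open>Stated for arbitrary triples, so that it also applies to the swapped one when
    the chosen end \<open>x\<close> of \<open>S\<close> lies in \<open>T'\<close>.\<close>
  have main: "S = S' \<and> T = T'"
    if \<omega>: "(F, S, T) \<in> configs P" and \<omega>': "(F', S', T') \<in> configs P"
      and un: "?E S \<union> ?E T = ?E S' \<union> ?E T'" and x: "x \<in> ?E S" "x \<in> ?E S'" for F S T F' S' T' x
  proof -
    note c = configsD[OF \<omega>] and c' = configsD[OF \<omega>']
    have apart: "\<not> comparable p q" if "(F, S, T) \<in> configs P" "p \<in> ?E S" "q \<in> ?E T" for F S T p q
      using configs_apart[OF that(1)] that(2,3) lows_subset highs_subset by blast
    have S: "?E S = ?E S'"
      using conn_ends[OF c(7)] conn_ends[OF c'(7)] un x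
      by (rule conn_component_eq) (use apart[OF \<omega>] apart[OF \<omega>'] in blast)+
    have disj: "?E S \<inter> ?E T = {}" if "(F, S, T) \<in> configs P" for F S T
      using configsD(6)[OF that] lows_subset highs_subset by blast
    have "?E T = ?E T'"
      using un S disj[OF \<omega>] disj[OF \<omega>'] by blast
    then show ?thesis
      using S config_order_hull_ends[OF \<omega>] config_order_hull_ends[OF \<omega>']
        config_order_hull_ends[OF configs_swap[OF \<omega>]] config_order_hull_ends[OF configs_swap[OF \<omega>']]
      by metis
  qed
  obtain x where x: "x \<in> ?E S"
    using lows_nonempty[OF configsD(7)[OF \<omega>]] by blast
  have "S = S' \<and> T = T' \<or> S = T' \<and> T = S'"
  proof (cases "x \<in> ?E S'")
    case True
    then show ?thesis
      using main[OF \<omega> \<omega>' un x] by simp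
  next
    case False
    then have "x \<in> ?E T'"
      using x un by blast
    then show ?thesis
      using main[OF \<omega> configs_swap[OF \<omega>'] _ x] un by (simp add: Un_commute)
  qed
  moreover have "F = F'"
  proof -
    let ?R = "\<lambda>U M. {p \<in> P. p \<notin> U \<and> (\<exists>s\<in>U. s \<le> p)} \<union> {p \<in> P. \<exists>m\<in>M. m \<le> p}"
    have un': "S \<union> T = S' \<union> T'"
      using calculation by auto
    have "F = ?R (S \<union> T) (core F (S \<union> T))"
      by (rule config_filter[OF \<omega>])
    also have "\<dots> = ?R (S' \<union> T') (core F' (S' \<union> T'))"
      by (rule arg_cong2[OF un' core])
    also have "\<dots> = F'"
      by (rule config_filter[OF \<omega>', symmetric])
    finally show ?thesis .
  qed
  ultimately show "F = F' \<and> (S = S' \<and> T = T' \<or> S = T' \<and> T = S')"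
    by simp
qed (use chain_square_swap in auto)

section \<open>Faces of the chain polytope give configurations\<close>

text \<open>Between two antichains all comparabilities of a connected union point the same way:
  elements with neighbours both above and below would produce two comparable elements of one
  antichain. Which antichain is the lower one is not known in advance.\<close>

lemma order_hull_lows_highs:
  assumes X: "antichain_in P X" and Y: "antichain_in P Y" and "X \<inter> Y = {}" and conn: "conn (X \<union> Y)"
  shows "lows (order_hull P (X \<union> Y)) = X \<and> highs (order_hull P (X \<union> Y)) = Y \<or>
    lows (order_hull P (X \<union> Y)) = Y \<and> highs (order_hull P (X \<union> Y)) = X"
proof -
  have oriented: "lows (order_hull P (X \<union> Y)) = X \<and> highs (order_hull P (X \<union> Y)) = Y"
    if X: "antichain_in P X" and Y: "antichain_in P Y" and conn: "conn (X \<union> Y)"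
      and xy: "x \<in> X" "y \<in> Y" "x < y" for X Y x y
  proof -
    have anti: "p \<in> X \<Longrightarrow> q \<in> X \<Longrightarrow> \<not> p < q" "p \<in> Y \<Longrightarrow> q \<in> Y \<Longrightarrow> \<not> p < q" for p q
      using X Y by (auto simp: antichain_in_def)
    have sub: "X \<subseteq> P" "Y \<subseteq> P"
      using X Y by (auto simp: antichain_in_def)
    \<comment> \<open>The orientation carried along the walk: members of \<open>X\<close> have
      something of \<open>Y\<close> above them, members of \<open>Y\<close> something of
      \<open>X\<close> below.\<close>
    let ?Q = "\<lambda>p. p \<in> X \<and> (\<exists>q\<in>Y. p < q) \<or> p \<in> Y \<and> (\<exists>q\<in>X. q < p)"
    have Q: "?Q w" if "w \<in> X \<union> Y" for w
      using conn _ that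
    proof (rule conn_induct)
      show "x \<in> X \<union> Y" "?Q x"
        using xy by auto
      fix p q assume pq: "p \<in> X \<union> Y" "q \<in> X \<union> Y" "comparable p q" "?Q p"
      consider "p = q" | "p < q" | "q < p"
        using pq(3) by (auto simp: comparable_def le_less)
      then show "?Q q"
      proof cases
        case 2
        have "p \<in> X"
        proof (rule ccontr)
          assume "p \<notin> X"
          then obtain r where "r \<in> X" "r < p" "p \<in> Y"
            using pq(4) by blast
          with 2 anti pq(2) less_trans[OF \<open>r < p\<close> 2] show False by blast
        qed
        with 2 anti(1) pq(2) show ?thesis by blast
      next
        case 3
        have "p \<in> Y"
        proof (rule ccontr)
          assume "p \<notin> Y"
          then obtain r where "r \<in> Y" "p < r" "p \<in> X"
            using pq(4) by blast
          with 3 anti pq(2) less_trans[OF 3 \<open>p < r\<close>] show False by blast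
        qed
        with 3 anti(2) pq(2) show ?thesis by blast
      qed (use pq in simp)
    qed
    have XB: "p \<in> order_hull P (X \<union> Y)" if "p \<in> X \<union> Y" for p
      using that sub by (auto simp: order_hull_def)
    have below: "\<exists>q\<in>X. q \<le> p" if p: "p \<in> order_hull P (X \<union> Y)" for p
    proof -
      obtain k where k: "k \<in> X \<union> Y" "k \<le> p"
        using p by (auto simp: order_hull_def)
      then show ?thesis
        using Q[OF k(1)] by (meson less_imp_le order_trans)
    qed
    have above: "\<exists>q\<in>Y. p \<le> q" if p: "p \<in> order_hull P (X \<union> Y)" for p
    proof -
      obtain k where k: "k \<in> X \<union> Y" "p \<le> k"
        using p by (auto simp: order_hull_def)
      then show ?thesis
        using Q[OF k(1)] by (meson less_imp_le order_trans)
    qed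
    have lows: "lows (order_hull P (X \<union> Y)) = X"
    proof
      show "lows (order_hull P (X \<union> Y)) \<subseteq> X"
      proof
        fix p assume p: "p \<in> lows (order_hull P (X \<union> Y))"
        then obtain q where q: "q \<in> X" "q \<le> p"
          using below lows_subset by blast
        then have "\<not> q < p"
          using p XB by (auto simp: lows_def)
        with q show "p \<in> X"
          by (auto simp: less_le)
      qed
      show "X \<subseteq> lows (order_hull P (X \<union> Y))"
      proof
        fix p assume p: "p \<in> X"
        have "\<not> r < p" if r: "r \<in> order_hull P (X \<union> Y)" for r
        proof
          assume "r < p"
          obtain q where "q \<in> X" "q \<le> r"
            using below[OF r] by auto
          with \<open>r < p\<close> anti(1)[of q p] p show False
            by (meson le_less_trans)
        qed
        with p XB show "p \<in> lows (order_hull P (X \<union> Y))"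
          by (simp add: lows_def)
      qed
    qed
    have disj: "p \<notin> X" if "p \<in> Y" for p
      using Q[of p] that anti by blast
    have "highs (order_hull P (X \<union> Y)) = Y"
    proof
      show "highs (order_hull P (X \<union> Y)) \<subseteq> Y"
      proof
        fix p assume p: "p \<in> highs (order_hull P (X \<union> Y))"
        then obtain q where q: "q \<in> Y" "p \<le> q"
          using above highs_subset by blast
        then have "\<not> p < q"
          using p XB by (auto simp: highs_def)
        with q show "p \<in> Y"
          by (auto simp: less_le)
      qed
      show "Y \<subseteq> highs (order_hull P (X \<union> Y))"
      proof
        fix p assume p: "p \<in> Y"
        have "\<not> p < r" if r: "r \<in> order_hull P (X \<union> Y)" for r
        proof
          assume "p < r"
          obtain q where "q \<in> Y" "r \<le> q"
            using above[OF r] by auto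
          with \<open>p < r\<close> anti(2)[of p q] p show False
            by (meson less_le_trans)
        qed
        with p XB disj show "p \<in> highs (order_hull P (X \<union> Y))"
          by (simp add: highs_def lows)
      qed
    qed
    with lows show ?thesis by simp
  qed
  \<comment> \<open>Without a strict comparability a connected union is one point; then one
    antichain is empty and plays the part of \<open>highs\<close>.\<close>
  consider (up) x y where "x \<in> X" "y \<in> Y" "x < y" | (down) x y where "x \<in> X" "y \<in> Y" "y < x"
    | (none) "\<And>x y. x \<in> X \<union> Y \<Longrightarrow> y \<in> X \<union> Y \<Longrightarrow> comparable x y \<Longrightarrow> x = y"
    using X Y unfolding antichain_in_def comparable_def le_less by blast
  then show ?thesis
  proof cases
    case up
    then show ?thesis using oriented[OF X Y conn] by blast
  next
    case down
    then show ?thesis using oriented[OF Y X, of y x] conn by (simp add: Un_commute)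
  next
    case none
    obtain k where "k \<in> X \<union> Y"
      using conn_nonempty[OF conn] by auto
    then have k: "X \<union> Y = {k}"
      using none by (intro conn_closed[OF conn, symmetric]) auto
    then have "k \<in> P"
      using X Y by (auto simp: antichain_in_def)
    then have "order_hull P (X \<union> Y) = {k}"
      unfolding k by (auto simp: order_hull_def)
    moreover have "lows {k} = {k}" "highs {k} = {}"
      by (auto simp: lows_def highs_def)
    moreover have "X = {k} \<and> Y = {} \<or> X = {} \<and> Y = {k}"
      using k \<open>X \<inter> Y = {}\<close> subset_singletonD[of X k] subset_singletonD[of Y k] by auto
    ultimately show ?thesis by auto
  qed
qed

text \<open>For a closed part \<open>E\<close> of the symmetric difference of \<open>A\<close> and
  \<open>B\<close>, toggling membership on \<open>E\<close> in both \<open>A\<close> and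
  \<open>D\<close> gives two antichains with the same intersection and union. The toggled
  \<open>A\<close> is thus a corner, and only \<open>B\<close> is possible.\<close>

lemma chain_square_conn:
  assumes face: "convex hull (chi ` {A, B, C, D}) face_of chain_polytope P"
    and par: "parallelogram A B C D"
  shows "conn ((A - B) \<union> (B - A))"
proof (rule connI)
  have AD: "A \<inter> D = B \<inter> C" "A \<union> D = B \<union> C"
    using par by (auto simp: parallelogram_def)
  have anti: "antichain_in P A" "antichain_in P B" "antichain_in P C" "antichain_in P D"
    using chi_in_square_face[OF face] unfolding chi_in_chain_polytope_iff by auto
  have less: "\<not> x < y" if "x \<in> Z" "y \<in> Z" "Z \<in> {A, B, C, D}" for x y Z
    using that anti by (auto simp: antichain_in_def)
  show "(A - B) \<union> (B - A) \<noteq> {}"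
    using parallelogram_distinct(1)[OF par] by blast
  fix E assume E: "E \<subseteq> (A - B) \<union> (B - A)" "E \<noteq> {}"
    and closed: "\<And>x y. x \<in> E \<Longrightarrow> y \<in> (A - B) \<union> (B - A) \<Longrightarrow> comparable x y \<Longrightarrow> y \<in> E"
  have closed': "y \<notin> (A - B) \<union> (B - A)" if "x \<in> E" "y \<notin> E" "x < y \<or> y < x" for x y
    using closed[OF that(1), of y] that(2,3) less_imp_le unfolding comparable_def by blast
  have ABC: "x \<in> A \<Longrightarrow> x \<in> B \<or> x \<in> C" "x \<in> D \<Longrightarrow> x \<in> B \<or> x \<in> C" for x
    using AD(2) by blast+
  have E_D: "x \<in> D \<longleftrightarrow> x \<notin> A" "x \<in> B \<longleftrightarrow> x \<notin> A" "x \<in> C \<longleftrightarrow> x \<in> A" if "x \<in> E" for x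
    using that E(1) AD by blast+
  let ?A = "(A - E) \<union> (E - A)" and ?D = "(D - E) \<union> (E - D)"
  \<comment> \<open>A kept \<open>x\<close> comparable to an added \<open>y\<close> is not in the
    symmetric difference, as \<open>E\<close> is closed, so it lies in \<open>B\<close>; but
    \<open>y\<close> lies in the antichain \<open>B\<close> too.\<close>
  have mixed: False if "x \<in> A" "x \<notin> E" "y \<in> E" "y \<notin> A" "x < y \<or> y < x" for x y
  proof -
    have "x \<in> B"
      using closed'[OF that(3,2)] that by blast
    moreover have "y \<in> B"
      using E_D[OF that(3)] that by blast
    ultimately show False
      using less[of x B y] less[of y B x] that(5) by blast
  qed
  \<comment> \<open>Here \<open>y\<close> lies in both \<open>A\<close> and \<open>C\<close>, and
    the kept \<open>x\<close> lies in at least one of them.\<close>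
  have mixed': False if "x \<in> D" "x \<notin> E" "y \<in> E" "y \<notin> D" "x < y \<or> y < x" for x y
  proof -
    have y: "y \<in> A" "y \<in> C"
      using E_D[OF that(3)] that by blast+
    have "x \<in> A \<or> x \<in> C"
      using closed'[OF that(3,2)] that ABC(2) by blast
    then show False
      using less[of x A y] less[of y A x] less[of x C y] less[of y C x] y that(5) by blast
  qed
  have "antichain_in P ?A"
    unfolding antichain_in_def
  proof (intro conjI ballI notI)
    show "?A \<subseteq> P"
      using E(1) anti by (auto simp: antichain_in_def)
    fix x y assume xy: "x \<in> ?A" "y \<in> ?A" "x < y"
    consider "x \<in> A" "y \<in> A" | "x \<in> B" "y \<in> B" | "x \<in> A" "x \<notin> E" "y \<in> E" "y \<notin> A"
      | "y \<in> A" "y \<notin> E" "x \<in> E" "x \<notin> A"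
      using xy(1,2) E_D(2) by blast
    then show False
      using less[of x A y] less[of x B y] mixed[of x y] mixed[of y x] xy(3) by cases auto
  qed
  moreover have "antichain_in P ?D"
    unfolding antichain_in_def
  proof (intro conjI ballI notI)
    show "?D \<subseteq> P"
      using E(1) anti by (auto simp: antichain_in_def)
    fix x y assume xy: "x \<in> ?D" "y \<in> ?D" "x < y"
    consider "x \<in> D" "y \<in> D" | "x \<in> A" "y \<in> A" | "x \<in> D" "x \<notin> E" "y \<in> E" "y \<notin> D"
      | "y \<in> D" "y \<notin> E" "x \<in> E" "x \<notin> D"
      using xy(1,2) E_D(1) by blast
    then show False
      using less[of x D y] less[of x A y] mixed'[of x y] mixed'[of y x] xy(3) by cases auto
  qed
  moreover have "?A \<inter> ?D = A \<inter> D" "?A \<union> ?D = A \<union> D"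
    using E_D(1) by blast+
  ultimately have "?A \<in> {A, B, C, D}"
    by (intro square_face_closed[OF face parallelogram_distinct(3)[OF par], of _ ?D])
      (simp_all only: chi_in_chain_polytope_iff)
  then consider "?A = A" | "?A = B" | "?A = C" | "?A = D"
    by blast
  then show "E = (A - B) \<union> (B - A)"
  proof cases
    case 1
    then have "E = {}" by blast
    with E(2) show ?thesis by simp
  next
    case 2
    then show ?thesis by blast
  next
    case 3
    obtain x where "x \<in> E" using E(2) by auto
    then have "x \<in> ?A \<longleftrightarrow> x \<notin> A" by blast
    with 3 E_D(3)[OF \<open>x \<in> E\<close>] show ?thesis by blast
  next
    case 4
    \<comment> \<open>Where \<open>A\<close> and \<open>C\<close> differ nothing is toggled, yet
      \<open>A\<close> and \<open>D\<close> differ there, so the toggled \<open>A\<close> cannot be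
      \<open>D\<close>.\<close>
    obtain x where x: "x \<in> A \<longleftrightarrow> x \<notin> C"
      using parallelogram_distinct(2)[OF par] by blast
    then have "x \<in> D \<longleftrightarrow> x \<notin> A"
      using AD by blast
    moreover have "x \<notin> E"
      using E_D(3) x by blast
    ultimately show ?thesis
      using 4 by blast
  qed
qed

lemma order_hull_apart:
  assumes "\<And>x y. x \<in> K \<Longrightarrow> y \<in> L \<Longrightarrow> \<not> comparable x y" "x \<in> order_hull P K" "y \<in> order_hull P L"
  shows "\<not> comparable x y"
proof -
  obtain k k' l l' where "k \<in> K" "k' \<in> K" "k \<le> x" "x \<le> k'" "l \<in> L" "l' \<in> L" "l \<le> y" "y \<le> l'"
    using assms(2,3) by (auto simp: order_hull_def)
  then show ?thesis
    using assms(1)[of k l'] assms(1)[of k' l] unfolding comparable_def by (meson order_trans)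
qed

text \<open>Every hull element is comparable to elements of \<open>K\<close>, so a closed part
  reaches into \<open>K\<close>, fills it, and from there fills the hull.\<close>

lemma conn_order_hull:
  assumes "conn K" "K \<subseteq> P"
  shows "conn (order_hull P K)"
proof (rule connI)
  have K: "K \<subseteq> order_hull P K"
    using assms(2) by (auto simp: order_hull_def)
  then show "order_hull P K \<noteq> {}"
    using conn_nonempty[OF assms(1)] by auto
  fix E assume E: "E \<subseteq> order_hull P K" "E \<noteq> {}"
    and closed: "\<And>x y. x \<in> E \<Longrightarrow> y \<in> order_hull P K \<Longrightarrow> comparable x y \<Longrightarrow> y \<in> E"
  obtain e k where "e \<in> E" "k \<in> K" "k \<le> e"
    using E unfolding order_hull_def by blast
  then have "k \<in> E"
    using closed[of e k] K by (auto simp: comparable_def)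
  have "w \<in> E" if "w \<in> K" for w
    using assms(1) \<open>k \<in> K\<close> that \<open>k \<in> E\<close> by (rule conn_induct) (use closed K in blast)
  then have "order_hull P K \<subseteq> E"
    using closed unfolding order_hull_def comparable_def by blast
  with E(1) show "E = order_hull P K" by blast
qed

lemma config_of_components:
  fixes P :: "'a::{finite,order} set"
  assumes K: "conn K" "K \<subseteq> P" and L: "conn L" "L \<subseteq> P" and M: "antichain_in P M"
    and KL: "\<And>x y. x \<in> K \<Longrightarrow> y \<in> L \<Longrightarrow> \<not> comparable x y"
    and MK: "\<And>x y. x \<in> M \<Longrightarrow> y \<in> K \<union> L \<Longrightarrow> \<not> comparable x y"
  obtains F where "(F, order_hull P K, order_hull P L) \<in> configs P"
    "core F (order_hull P K \<union> order_hull P L) = M"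
proof -
  define S T where "S = order_hull P K" and "T = order_hull P L"
  have ST: "\<not> comparable x y" if "x \<in> S" "y \<in> T" for x y
    using order_hull_apart[OF KL] that unfolding S_def T_def by blast
  have MST: "\<not> comparable x y" if xy: "x \<in> M" "y \<in> S \<union> T" for x y
  proof -
    obtain k k' where "k \<in> K \<union> L" "k' \<in> K \<union> L" "k \<le> y" "y \<le> k'"
      using xy(2) unfolding S_def T_def order_hull_def by blast
    then show ?thesis
      using MK[OF xy(1)] unfolding comparable_def by (meson order_trans)
  qed
  have sub: "S \<subseteq> P" "T \<subseteq> P" "M \<subseteq> P"
    using M by (auto simp: S_def T_def order_hull_def antichain_in_def)
  have convex: "p \<in> S" if "x \<in> S" "y \<in> S" "x \<le> p" "p \<le> y" "p \<in> P" for x y p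
    using that unfolding S_def order_hull_def by (blast intro: order_trans)
  have convex': "p \<in> T" if "x \<in> T" "y \<in> T" "x \<le> p" "p \<le> y" "p \<in> P" for x y p
    using that unfolding T_def order_hull_def by (blast intro: order_trans)
  \<comment> \<open>By \<open>config_filter\<close> this is the only candidate for the
    filter.\<close>
  define F where "F = {p \<in> P. p \<notin> S \<union> T \<and> (\<exists>s\<in>S \<union> T. s \<le> p)} \<union> {p \<in> P. \<exists>m\<in>M. m \<le> p}"
  have up_M: "p \<notin> S \<union> T" if "m \<in> M" "m \<le> p" for m p
    using MST[OF that(1)] that(2) by (auto simp: comparable_def)
  have disj: "F \<inter> S = {}" "F \<inter> T = {}" "S \<inter> T = {}"
    using up_M ST unfolding F_def by (auto simp: comparable_def)
  have F_up: "y \<in> F" if "x \<in> F" "y \<in> P" "x \<le> y" for x y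
  proof (cases "\<exists>m\<in>M. m \<le> x")
    case True
    then show ?thesis
      using that by (auto simp: F_def intro: order_trans)
  next
    case False
    with \<open>x \<in> F\<close> obtain s where s: "s \<in> S \<union> T" "s \<le> x" and x: "x \<notin> S \<union> T" "x \<in> P"
      unfolding F_def by blast
    have sy: "s \<le> y"
      using s that by (meson order_trans)
    \<comment> \<open>Otherwise \<open>s\<close> and \<open>y\<close> lie in the same piece, since
      the pieces are incomparable, and convexity would put the intermediate \<open>x\<close> into
      it.\<close>
    have "y \<notin> S \<union> T"
    proof
      assume y: "y \<in> S \<union> T"
      have "comparable s y" "comparable y s"
        using sy by (auto simp: comparable_def)
      with y s ST consider "s \<in> S" "y \<in> S" | "s \<in> T" "y \<in> T"
        by blast
      then show False
        using convex[of s y x] convex'[of s y x] s(2) that(3) x by cases auto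
    qed
    then show ?thesis
      using s(1) sy that(2) by (auto simp: F_def)
  qed
  have S_up: "y \<in> F \<union> S" if "x \<in> S" "y \<in> P" "x \<le> y" for x y
    using that ST[OF that(1), of y] by (auto simp: F_def comparable_def)
  have T_up: "y \<in> F \<union> T" if "x \<in> T" "y \<in> P" "x \<le> y" for x y
    using that ST[of y x] by (auto simp: F_def comparable_def)
  have "F \<subseteq> P"
    by (auto simp: F_def)
  then have "filter_in P F" "filter_in P (F \<union> S)" "filter_in P (F \<union> T)"
    using F_up S_up T_up sub unfolding filter_in_def by blast+
  moreover have "conn S" "conn T"
    unfolding S_def T_def using conn_order_hull K L by auto
  ultimately have "(F, S, T) \<in> configs P"
    using disj by (simp add: configs_def)
  moreover have "core F (S \<union> T) = M"
  proof
    let ?N = "{p \<in> F. \<forall>s\<in>S \<union> T. \<not> comparable s p}"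
    have above: "\<exists>m\<in>M. m \<le> p" if "p \<in> ?N" for p
      using that by (auto simp: F_def comparable_def)
    have M_N: "M \<subseteq> ?N"
      using MST sub(3) comparable_sym unfolding F_def by blast
    show "core F (S \<union> T) \<subseteq> M"
    proof
      fix p assume p: "p \<in> core F (S \<union> T)"
      then obtain m where m: "m \<in> M" "m \<le> p"
        using above lows_subset unfolding core_def by blast
      then have "\<not> m < p"
        using p M_N unfolding core_def lows_def by blast
      with m show "p \<in> M"
        by (auto simp: less_le)
    qed
    show "M \<subseteq> core F (S \<union> T)"
    proof
      fix p assume p: "p \<in> M"
      have "\<not> q < p" if q: "q \<in> ?N" for q
      proof
        assume "q < p"
        obtain m where "m \<in> M" "m \<le> q"
          using above[OF q] by blast
        then have "m < p"
          using \<open>q < p\<close> by (meson le_less_trans)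
        with M p \<open>m \<in> M\<close> show False
          by (simp add: antichain_in_def)
      qed
      with p M_N show "p \<in> core F (S \<union> T)"
        unfolding core_def lows_def by blast
    qed
  qed
  ultimately show ?thesis
    using that unfolding S_def T_def by blast
qed

lemma chain_square_surj:
  fixes P :: "'a::{finite,order} set"
  assumes "X \<in> square_sets (chain_polytope P)"
  shows "X \<in> chain_square ` configs P"
proof -
  obtain A B C D where X: "X = {A, B, C, D}" and par: "parallelogram A B C D"
    and face: "convex hull (chi ` {A, B, C, D}) face_of chain_polytope P"
    using assms by (rule squareE)
  have AD: "A \<inter> D = B \<inter> C" "A \<union> D = B \<union> C"
    using par by (auto simp: parallelogram_def)
  have anti: "antichain_in P A" "antichain_in P B" "antichain_in P C" "antichain_in P D"
    using chi_in_square_face[OF face] unfolding chi_in_chain_polytope_iff by auto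
  have apart: "\<not> comparable x y" if "x \<in> Z" "y \<in> Z" "x \<noteq> y" "Z \<in> {A, B, C, D}" for x y Z
    using that anti by (auto simp: antichain_in_def comparable_def le_less)
  define M where "M = A \<inter> D"
  \<comment> \<open>\<open>K\<close> and \<open>L\<close> are what changes along the two directions
    of sides; \<open>M\<close> is what never changes.\<close>
  define K where "K = (A - B) \<union> (B - A)"
  define L where "L = (A - C) \<union> (C - A)"
  have K: "conn K" "K \<subseteq> P"
    using chain_square_conn[OF face par] anti by (auto simp: K_def antichain_in_def)
  have "convex hull (chi ` {A, C, B, D}) face_of chain_polytope P"
    using face by (simp only: insert_commute)
  then have L: "conn L" "L \<subseteq> P"
    using chain_square_conn[OF _ parallelogram_swap[OF par]] anti by (auto simp: L_def antichain_in_def)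
  have M: "antichain_in P M"
    using anti by (auto simp: M_def antichain_in_def)
  have KL: "\<not> comparable x y" if "x \<in> K" "y \<in> L" for x y
  proof -
    have "x \<noteq> y"
      using that AD unfolding K_def L_def by blast
    \<comment> \<open>Every side of \<open>K\<close> occurs together with every side of
      \<open>L\<close> in some corner, and corners are antichains.\<close>
    moreover have "\<exists>Z\<in>{A, B, C, D}. x \<in> Z \<and> y \<in> Z"
      using that AD unfolding K_def L_def by blast
    ultimately show ?thesis
      using apart by blast
  qed
  have MK: "\<not> comparable x y" if "x \<in> M" "y \<in> K \<union> L" for x y
  proof -
    have "x \<noteq> y"
      using that AD unfolding K_def L_def M_def by blast
    moreover have "\<exists>Z\<in>{A, B, C, D}. x \<in> Z \<and> y \<in> Z"
      using that AD unfolding K_def L_def M_def by blast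
    ultimately show ?thesis
      using apart by blast
  qed
  obtain F where F: "(F, order_hull P K, order_hull P L) \<in> configs P"
    and core: "core F (order_hull P K \<union> order_hull P L) = M"
    using K L M KL MK by (rule config_of_components)
  have sets: "A = M \<union> (A - B) \<union> (A - C)" "B = M \<union> (B - A) \<union> (A - C)"
    "C = M \<union> (A - B) \<union> (C - A)" "D = M \<union> (B - A) \<union> (C - A)"
    using AD unfolding M_def by blast+
  have sub: "antichain_in P (A - B)" "antichain_in P (B - A)" "antichain_in P (A - C)" "antichain_in P (C - A)"
    using anti by (auto simp: antichain_in_def)
  have loK: "lows (order_hull P K) = A - B \<and> highs (order_hull P K) = B - A \<or>
      lows (order_hull P K) = B - A \<and> highs (order_hull P K) = A - B"
    unfolding K_def by (rule order_hull_lows_highs[OF sub(1,2)]) (use K in \<open>auto simp: K_def\<close>)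
  have loL: "lows (order_hull P L) = A - C \<and> highs (order_hull P L) = C - A \<or>
      lows (order_hull P L) = C - A \<and> highs (order_hull P L) = A - C"
    unfolding L_def by (rule order_hull_lows_highs[OF sub(3,4)]) (use L in \<open>auto simp: L_def\<close>)
  \<comment> \<open>Either orientation of \<open>K\<close> and of \<open>L\<close> is possible, but
    exchanging lower and upper sides only permutes the corners.\<close>
  have "chain_square (F, order_hull P K, order_hull P L) = {A, B, C, D}"
    using loK loL sets unfolding chain_square_def prod.case core Let_def
    by (elim disjE conjE) (simp_all only: insert_commute)
  with F X show ?thesis by blast
qed

text \<open>Two maps with the same fibres have equally many values; neither has to be
  injective.\<close>

lemma card_image_eq:
  assumes "\<And>x y. x \<in> A \<Longrightarrow> y \<in> A \<Longrightarrow> f x = f y \<longleftrightarrow> g x = g y"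
  shows "card (f ` A) = card (g ` A)"
proof -
  have g: "g (inv_into A f (f x)) = g x" if "x \<in> A" for x
    using that assms inv_into_into[of "f x" f A] f_inv_into_f[of "f x" f A] by blast
  have "bij_betw (\<lambda>u. g (inv_into A f u)) (f ` A) (g ` A)"
    unfolding bij_betw_def inj_on_def
  proof safe
    fix x y assume "x \<in> A" "y \<in> A" "g (inv_into A f (f x)) = g (inv_into A f (f y))"
    then show "f x = f y"
      using assms g by metis
  qed (use g in force)+
  then show ?thesis
    by (rule bij_betw_same_card)
qed

theorem theorem5p11:
  fixes P :: "'a::{finite,order} set"
  shows "num_square_faces (order_polytope P) = num_square_faces (chain_polytope P)"
proof -
  have "square_sets (order_polytope P) = order_square ` configs P"
    using order_square_in order_square_surj by fast
  moreover have "square_sets (chain_polytope P) = chain_square ` configs P"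
    using chain_square_in chain_square_surj by fast
  \<comment> \<open>Both maps identify a triple exactly with its swap.\<close>
  moreover have "card (order_square ` configs P) = card (chain_square ` configs P)"
    by (rule card_image_eq) (force simp: order_square_eq_iff chain_square_eq_iff)
  moreover have "num_square_faces (order_polytope P) = card (square_sets (order_polytope P))"
    by (rule num_square_faces_eq[OF compact_order_polytope convex_order_polytope extreme_point_order_polytope])
  moreover have "num_square_faces (chain_polytope P) = card (square_sets (chain_polytope P))"
    by (rule num_square_faces_eq[OF compact_chain_polytope convex_chain_polytope extreme_point_chain_polytope])
  ultimately show ?thesis by simp
qed

end
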